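(* Let $0<\alpha<1$. Let $\{N_{\alpha,1}^{(1)}(t_1,t_2)\}$ and $\{N_{1,\alpha}^{(1)}(t_1,t_2)\}$, $(t_1,t_2)\in\mathbb{R}^2_+$, be fractional Poisson random fields with parameter $1$ and indices $(\alpha_1,\alpha_2)=(\alpha,1)$ and $(1,\alpha)$, respectively, and let $Z_1,Z_2,\dots$ be iid standard normal random variables independent of them. Let $\{W(t_1,t_2),\ (t_1,t_2)\in\mathbb{R}^2_+\}$ be the two parameter Brownian sheet and $\{L_\alpha(t),\ t\ge0\}$ an inverse $\alpha$-stable subordinator independent of $W$. Then, for each $(t_1,t_2)\in\mathbb{R}^2_+$, as $n\to\infty$, $$n^{-1/2}\sum_{j=1}^{N_{\alpha,1}^{(1)}(t_1,nt_2)}Z_j\ \text{ converges in distribution to }\ W(L_\alpha(t_1),t_2),$$ and $$n^{-1/2}\sum_{j=1}^{N_{1,\alpha}^{(1)}(nt_1,t_2)}Z_j\ \text{ converges in distribution to }\ W(t_1,L_\alpha(t_2)).$$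
   Context: $\mathbb{R}_+=[0,\infty)$. An empty sum is $0$. Fractional Poisson random field with parameter $\lambda>0$ and indices $0<\alpha_1,\alpha_2\le1$: a nonnegative-integer-valued random field $\{N_{\alpha_1,\alpha_2}(t_1,t_2)\}$ on $\mathbb{R}^2_+$ whose one-point distribution $p_{\alpha_1,\alpha_2}(n,t_1,t_2)=\mathrm{Pr}\{N_{\alpha_1,\alpha_2}(t_1,t_2)=n\}$, $n\ge0$, solves $$\frac{\partial^{\alpha_1+\alpha_2}}{\partial t_2^{\alpha_2}\partial t_1^{\alpha_1}}p_{\alpha_1,\alpha_2}(n,t_1,t_2)=(n+1)\lambda p_{\alpha_1,\alpha_2}(n+1,t_1,t_2)-(2n+1)\lambda p_{\alpha_1,\alpha_2}(n,t_1,t_2)+n\lambda p_{\alpha_1,\alpha_2}(n-1,t_1,t_2)$$ with $p_{\alpha_1,\alpha_2}(0,0,0)=p_{\alpha_1,\alpha_2}(0,t_1,0)=p_{\alpha_1,\alpha_2}(0,0,t_2)=1$, the derivatives being Caputo: $\frac{1}{\Gamma(1-\alpha)}\int_0^t\frac{g'(s)}{(t-s)^\alpha}\,\mathrm{d}s$ for $0<\alpha<1$, and $g'(t)$ for $\alpha=1$. When one of the indices is $1$, it is known (and may be used) that its Laplace transform is $\mathbb{E}e^{-uN_{\alpha_1,\alpha_2}(t_1,t_2)}=\sum_{k=0}^{\infty}\frac{k!\,(\lambda t_1^{\alpha_1}t_2^{\alpha_2}(e^{-u}-1))^k}{\Gamma(k\alpha_1+1)\Gamma(k\alpha_2+1)}$,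 $u>0$. Brownian sheet: a process $\{W(t_1,t_2)\}$ with $W(0,t_2)=W(t_1,0)=0$ a.s., with independent and stationary rectangular increments, the increment $W(t_1,t_2)-W(s_1,t_2)-W(t_1,s_2)+W(s_1,s_2)$ being normal with mean zero and variance $(t_1-s_1)(t_2-s_2)$. Inverse stable subordinator: $L_\alpha(t)=\inf\{s\ge0:H_\alpha(s)\ge t\}$, where $\{H_\alpha(t),t\ge0\}$ is the non-decreasing Lévy process with $\mathbb{E}e^{-uH_\alpha(t)}=e^{-tu^\alpha}$, $u>0$.
   Formalization: The Brownian sheet W is assumed to have almost surely continuous paths; without this the claim fails, since W may be modified at the random point L_α(t_1) without changing its finite-dimensional laws or its independence of L_α. *)

theory Defs
  imports "HOL-Probability.Probability"
begin

section \<open>Caputo derivatives\<close>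

text \<open>
  Relational form, so that existence of the derivative (and convergence of the integral) is part
  of the assertion. For \<open>\<alpha> < 1\<close> the function has to be differentiable on the open interval
  \<open>(0, t)\<close> only; \<open>g'\<close> may have an integrable singularity at \<open>0\<close>.
\<close>

definition has_caputo_derivative :: "real \<Rightarrow> (real \<Rightarrow> real) \<Rightarrow> real \<Rightarrow> real \<Rightarrow> bool" where
  "has_caputo_derivative \<alpha> g D t \<longleftrightarrow>
     (if \<alpha> = 1 then (g has_real_derivative D) (at t)
      else (\<forall>s\<in>{0<..<t}. g field_differentiable (at s)) \<and>
           set_integrable lborel {0<..<t} (\<lambda>s. deriv g s / (t - s) powr \<alpha>) \<and>
           D = 1 / Gamma (1 - \<alpha>) * (LBINT s:{0<..<t}. deriv g s / (t - s) powr \<alpha>))"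

text \<open>
  The mixed derivative of order \<open>\<alpha>1\<close> in \<open>t1\<close>, followed by order \<open>\<alpha>2\<close> in \<open>t2\<close>, equals \<open>F\<close> at all
  interior points of the quadrant; \<open>q\<close> is the intermediate derivative with respect to \<open>t1\<close>.
\<close>

definition has_mixed_caputo_derivative ::
    "real \<Rightarrow> real \<Rightarrow> (real \<Rightarrow> real \<Rightarrow> real) \<Rightarrow> (real \<Rightarrow> real \<Rightarrow> real) \<Rightarrow> bool" where
  "has_mixed_caputo_derivative \<alpha>1 \<alpha>2 p F \<longleftrightarrow>
     (\<exists>q. \<forall>t1>0. \<forall>t2>0.
        has_caputo_derivative \<alpha>1 (\<lambda>s. p s t2) (q t1 t2) t1 \<and>
        has_caputo_derivative \<alpha>2 (\<lambda>s. q t1 s) (F t1 t2) t2)"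

section \<open>Fractional Poisson random fields\<close>

definition one_point_prob :: "'a measure \<Rightarrow> (real \<Rightarrow> real \<Rightarrow> 'a \<Rightarrow> nat) \<Rightarrow> nat \<Rightarrow> real \<Rightarrow> real \<Rightarrow> real" where
  "one_point_prob M N n t1 t2 = measure M {\<omega> \<in> space M. N t1 t2 \<omega> = n}"

text \<open>
  For \<open>n = 0\<close> the truncated \<open>n - 1\<close> is harmless because the term has the factor \<open>n\<close>. The equation
  can hold only for \<open>t1, t2 > 0\<close>: on the axes the field vanishes, so that for \<open>n = 0\<close> the right-hand
  side is \<open>-\<lambda>\<close> there.
\<close>

definition fractional_poisson_field ::
    "'a measure \<Rightarrow> real \<Rightarrow> real \<Rightarrow> real \<Rightarrow> (real \<Rightarrow> real \<Rightarrow> 'a \<Rightarrow> nat) \<Rightarrow> bool" where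
  "fractional_poisson_field M lam \<alpha>1 \<alpha>2 N \<longleftrightarrow>
     0 < lam \<and> 0 < \<alpha>1 \<and> \<alpha>1 \<le> 1 \<and> 0 < \<alpha>2 \<and> \<alpha>2 \<le> 1 \<and>
     (\<forall>t1\<ge>0. \<forall>t2\<ge>0. N t1 t2 \<in> measurable M (count_space UNIV)) \<and>
     (\<forall>n. has_mixed_caputo_derivative \<alpha>1 \<alpha>2 (one_point_prob M N n)
        (\<lambda>t1 t2. real (n + 1) * lam * one_point_prob M N (n + 1) t1 t2
               - real (2 * n + 1) * lam * one_point_prob M N n t1 t2
               + real n * lam * one_point_prob M N (n - 1) t1 t2)) \<and>
     (\<forall>t\<ge>0. one_point_prob M N 0 t 0 = 1 \<and> one_point_prob M N 0 0 t = 1)"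

text \<open>
  The known Laplace transform of a fractional Poisson random field one of whose indices is \<open>1\<close>. It
  is kept apart from the definition of the field because it is an imported result.
\<close>

definition fractional_poisson_laplace ::
    "'a measure \<Rightarrow> real \<Rightarrow> real \<Rightarrow> real \<Rightarrow> (real \<Rightarrow> real \<Rightarrow> 'a \<Rightarrow> nat) \<Rightarrow> bool" where
  "fractional_poisson_laplace M lam \<alpha>1 \<alpha>2 N \<longleftrightarrow>
     (\<forall>t1\<ge>0. \<forall>t2\<ge>0. \<forall>u>0.
        integral\<^sup>L M (\<lambda>\<omega>. exp (- u * real (N t1 t2 \<omega>))) =
        (\<Sum>k. fact k * (lam * t1 powr \<alpha>1 * t2 powr \<alpha>2 * (exp (- u) - 1)) ^ k /
              (Gamma (real k * \<alpha>1 + 1) * Gamma (real k * \<alpha>2 + 1))))"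

section \<open>Independence of processes\<close>

text \<open>
  The library's \<open>indep_var\<close> needs both random variables to have the same type, so independence of
  two processes is expressed through the sigma-algebras they generate.
\<close>

definition process_events :: "'a measure \<Rightarrow> 'i set \<Rightarrow> 'b measure \<Rightarrow> ('i \<Rightarrow> 'a \<Rightarrow> 'b) \<Rightarrow> 'a set set" where
  "process_events M I S X =
     sigma_sets (space M) {X i -` A \<inter> space M | i A. i \<in> I \<and> A \<in> sets S}"

section \<open>Brownian sheet\<close>

definition rect_increment :: "(real \<Rightarrow> real \<Rightarrow> 'a \<Rightarrow> real) \<Rightarrow> real \<Rightarrow> real \<Rightarrow> real \<Rightarrow> real \<Rightarrow> 'a \<Rightarrow> real" where
  "rect_increment W s1 t1 s2 t2 \<omega> = W t1 t2 \<omega> - W s1 t2 \<omega> - W t1 s2 \<omega> + W s1 s2 \<omega>"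

text \<open>
  Independent increments: over every finite family of pairwise disjoint rectangles. As usual, the
  sheet is taken with almost surely continuous paths; without this, \<open>W\<close> could be changed at the
  random point \<open>L(t1)\<close> and the law of \<open>W (L(t1), t2)\<close> would not be determined.
\<close>

definition brownian_sheet :: "'a measure \<Rightarrow> (real \<Rightarrow> real \<Rightarrow> 'a \<Rightarrow> real) \<Rightarrow> bool" where
  "brownian_sheet M W \<longleftrightarrow>
     (\<forall>t1\<ge>0. \<forall>t2\<ge>0. W t1 t2 \<in> borel_measurable M) \<and>
     (\<forall>t\<ge>0. (AE \<omega> in M. W 0 t \<omega> = 0) \<and> (AE \<omega> in M. W t 0 \<omega> = 0)) \<and>
     (\<forall>(n::nat) s1 t1 s2 t2.
        (\<forall>i<n. 0 \<le> s1 i \<and> s1 i < t1 i \<and> 0 \<le> s2 i \<and> s2 i < t2 i) \<and>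
        disjoint_family_on (\<lambda>i. {s1 i<..t1 i} \<times> {s2 i<..t2 i}) {..<n} \<longrightarrow>
        prob_space.indep_vars M (\<lambda>_. borel)
          (\<lambda>i. rect_increment W (s1 i) (t1 i) (s2 i) (t2 i)) {..<n}) \<and>
     (\<forall>s1 t1 s2 t2 h1 h2. 0 \<le> s1 \<and> s1 < t1 \<and> 0 \<le> s2 \<and> s2 < t2 \<and> 0 \<le> h1 \<and> 0 \<le> h2 \<longrightarrow>
        distr M borel (rect_increment W (s1 + h1) (t1 + h1) (s2 + h2) (t2 + h2)) =
        distr M borel (rect_increment W s1 t1 s2 t2)) \<and>
     (\<forall>s1 t1 s2 t2. 0 \<le> s1 \<and> s1 < t1 \<and> 0 \<le> s2 \<and> s2 < t2 \<longrightarrow>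
        distributed M lborel (rect_increment W s1 t1 s2 t2)
          (\<lambda>x. ennreal (normal_density 0 (sqrt ((t1 - s1) * (t2 - s2))) x))) \<and>
     (AE \<omega> in M. continuous_on ({0..} \<times> {0..}) (\<lambda>(t1, t2). W t1 t2 \<omega>))"

section \<open>Stable subordinators and their inverses\<close>

definition levy_process :: "'a measure \<Rightarrow> (real \<Rightarrow> 'a \<Rightarrow> real) \<Rightarrow> bool" where
  "levy_process M H \<longleftrightarrow>
     (\<forall>t\<ge>0. H t \<in> borel_measurable M) \<and>
     (AE \<omega> in M. H 0 \<omega> = 0) \<and>
     (\<forall>n (\<tau>::nat \<Rightarrow> real). 0 \<le> \<tau> 0 \<and> (\<forall>i<n. \<tau> i \<le> \<tau> (Suc i)) \<longrightarrow>
        prob_space.indep_vars M (\<lambda>_. borel) (\<lambda>i \<omega>. H (\<tau> (Suc i)) \<omega> - H (\<tau> i) \<omega>) {..<n}) \<and>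
     (\<forall>s\<ge>0. \<forall>t\<ge>0. distr M borel (\<lambda>\<omega>. H (s + t) \<omega> - H s \<omega>) = distr M borel (H t)) \<and>
     (AE \<omega> in M. (\<forall>t\<ge>0. continuous (at_right t) (\<lambda>s. H s \<omega>)) \<and>
                 (\<forall>t>0. \<exists>l. ((\<lambda>s. H s \<omega>) \<longlongrightarrow> l) (at_left t)))"

definition stable_subordinator :: "'a measure \<Rightarrow> real \<Rightarrow> (real \<Rightarrow> 'a \<Rightarrow> real) \<Rightarrow> bool" where
  "stable_subordinator M \<alpha> H \<longleftrightarrow>
     levy_process M H \<and>
     (AE \<omega> in M. mono_on {0..} (\<lambda>t. H t \<omega>)) \<and>
     (\<forall>t\<ge>0. \<forall>u>0. integral\<^sup>L M (\<lambda>\<omega>. exp (- u * H t \<omega>)) = exp (- t * u powr \<alpha>))"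

definition inverse_stable_subordinator :: "'a measure \<Rightarrow> real \<Rightarrow> (real \<Rightarrow> 'a \<Rightarrow> real) \<Rightarrow> bool" where
  "inverse_stable_subordinator M \<alpha> L \<longleftrightarrow>
     (\<forall>t\<ge>0. L t \<in> borel_measurable M) \<and>
     (\<exists>H. stable_subordinator M \<alpha> H \<and>
          (AE \<omega> in M. \<forall>t\<ge>0. L t \<omega> = Inf {s. 0 \<le> s \<and> t \<le> H s \<omega>}))"

section \<open>Convergence in distribution\<close>

text \<open>
  The path properties of \<open>W\<close> and \<open>L\<close> hold only almost surely, so a composition such as
  \<open>W (L(t1), t2)\<close> is a priori measurable only with respect to the completion; its law is therefore
  taken there. For a limit that is measurable as it stands this is the usual law.
\<close>

definition converges_in_distribution ::
    "'a measure \<Rightarrow> (nat \<Rightarrow> 'a \<Rightarrow> real) \<Rightarrow> 'b measure \<Rightarrow> ('b \<Rightarrow> real) \<Rightarrow> bool" where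
  "converges_in_distribution M X M' Y \<longleftrightarrow>
     weak_conv_m (\<lambda>n. distr M borel (X n)) (distr (completion M') borel Y)"

end

theory Submission
  imports Defs
begin

text \<open>
  Conditioning on the number of summands and using the given Laplace transform, the characteristic
  function of the normalized sum at \<open>\<theta>\<close> is \<open>E (c n (exp (- \<theta>\<^sup>2 / (2 n)) - 1))\<close>, where \<open>E\<close> is the
  (continuous) Mittag-Leffler function of order \<open>\<alpha>\<close> and \<open>c\<close> is \<open>t1\<^sup>\<alpha> t2\<close> or \<open>t2\<^sup>\<alpha> t1\<close>; it tends to
  \<open>E (- c \<theta>\<^sup>2 / 2)\<close>. Conditioning on the random time, the characteristic function of the limit is
  the Laplace transform of \<open>L t\<close> at a multiple of \<open>\<theta>\<^sup>2\<close>. Since \<open>L t \<le> s\<close> iff \<open>t \<le> H s\<close>,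
  self-similarity of \<open>H\<close> shows that \<open>L t\<close> is distributed as \<open>(t / H 1)\<^sup>\<alpha>\<close>. Its moments come from
  \<open>\<Gamma>(p) x\<^sup>-\<^sup>p = \<integral> u\<^sup>p\<^sup>-\<^sup>1 exp (- u x) du\<close> with \<open>x = H 1\<close>, and they show that this Laplace transform
  is again \<open>E\<close>. Levy's continuity theorem concludes.
\<close>

section \<open>Mittag-Leffler functions\<close>

definition mittag_leffler :: "real \<Rightarrow> real \<Rightarrow> real" where
  "mittag_leffler \<alpha> x = (\<Sum>k. x ^ k / Gamma (real k * \<alpha> + 1))"

text \<open>Restricting Euler's integral to \<open>t >= R\<close> and replacing
  \<open>t powr s\<close> there by its value at \<open>R\<close> leaves
  \<open>R powr s * exp (- R)\<close>. As \<open>R\<close> is free,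
  \<open>Gamma (k * \<alpha> + 1)\<close> outgrows every geometric sequence in
  \<open>k\<close>.\<close>

lemma powr_times_exp_le_Gamma:
  fixes s R :: real
  assumes "s \<ge> 0" "R > 0"
  shows "R powr s * exp (- R) \<le> Gamma (s + 1)"
proof (rule has_integral_le)
  show "((\<lambda>t. t powr (s + 1 - 1) / exp t) has_integral Gamma (s + 1)) {0..}"
    using assms by (intro Gamma_integral_real) auto
  have "((\<lambda>t. R powr s * exp (- 1 * t)) has_integral R powr s * (exp (- 1 * R) / 1)) {R..}"
    by (intro has_integral_mult_right has_integral_exp_minus_to_infinity) auto
  then have "((\<lambda>t. if t \<in> {R..} then R powr s * exp (- t) else 0) has_integral R powr s * exp (- R)) UNIV"
    by (subst has_integral_restrict_UNIV) simp
  then have "((\<lambda>t. if t \<in> {0..} then (if t \<in> {R..} then R powr s * exp (- t) else 0) else 0)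
      has_integral R powr s * exp (- R)) UNIV"
    by (rule has_integral_eq[rotated]) (use assms in auto)
  then show "((\<lambda>t. if t \<in> {R..} then R powr s * exp (- t) else 0) has_integral R powr s * exp (- R)) {0..}"
    by (subst (asm) has_integral_restrict_UNIV)
  show "(if t \<in> {R..} then R powr s * exp (- t) else 0) \<le> t powr (s + 1 - 1) / exp t"
    if "t \<in> {0..}" for t
    using that assms by (auto simp: exp_minus field_simps intro!: powr_mono2)
qed

lemma summable_mittag_leffler:
  fixes \<alpha> x :: real
  assumes "\<alpha> > 0"
  shows "summable (\<lambda>k. x ^ k / Gamma (real k * \<alpha> + 1))"
proof -
  \<comment> \<open>With this \<open>R\<close>, \<open>R powr \<alpha>\<close> is twice
    \<open>|x| + 1\<close>, so the terms are dominated by a geometric series of ratio 1/2. The added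
    1 keeps the base positive at \<open>x = 0\<close>.\<close>
  define R where "R = (2 * (\<bar>x\<bar> + 1)) powr (1 / \<alpha>)"
  have R: "R > 0" "R powr \<alpha> = 2 * (\<bar>x\<bar> + 1)"
    using assms by (auto simp: R_def powr_powr)
  have le: "norm (x ^ k / Gamma (real k * \<alpha> + 1)) \<le> exp R * (1 / 2) ^ k" for k
  proof -
    have G: "(2 * (\<bar>x\<bar> + 1)) ^ k * exp (- R) \<le> Gamma (real k * \<alpha> + 1)"
      using powr_times_exp_le_Gamma[of "real k * \<alpha>" R] assms R
      by (simp add: mult.commute powr_powr[symmetric] powr_realpow)
    have pos: "(2 * (\<bar>x\<bar> + 1)) ^ k * exp (- R) > 0" by simp
    have "norm (x ^ k / Gamma (real k * \<alpha> + 1)) = \<bar>x\<bar> ^ k / Gamma (real k * \<alpha> + 1)"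
      using less_le_trans[OF pos G] by (simp add: power_abs)
    also have "\<dots> \<le> (\<bar>x\<bar> + 1) ^ k / ((2 * (\<bar>x\<bar> + 1)) ^ k * exp (- R))"
      using G pos by (intro frac_le power_mono) auto
    also have "\<dots> = exp R * (1 / 2) ^ k"
    proof -
      have "y ^ k / ((2 * y) ^ k * exp (- R)) = exp R * (1 / 2) ^ k" if "y > 0" for y :: real
        using that by (simp add: exp_minus power_mult_distrib power_one_over field_simps)
      from this[of "\<bar>x\<bar> + 1"] show ?thesis by simp
    qed
    finally show ?thesis .
  qed
  show ?thesis
  proof (rule summable_comparison_test')
    show "summable (\<lambda>k. exp R * (1 / 2 :: real) ^ k)"
      by (intro summable_mult summable_geometric) simp
  qed (rule le)
qed

text \<open>A power series that converges everywhere is continuous. Continuity is what carries the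
  limit of the arguments over to the characteristic functions.\<close>

lemma isCont_mittag_leffler:
  assumes "\<alpha> > 0"
  shows "isCont (mittag_leffler \<alpha>) x"
proof -
  have "isCont (\<lambda>x. \<Sum>k. inverse (Gamma (real k * \<alpha> + 1)) * x ^ k) x"
    using summable_mittag_leffler[OF assms]
    by (intro isCont_powser_converges_everywhere) (simp add: divide_inverse mult.commute)
  then show ?thesis
    by (simp add: mittag_leffler_def[abs_def] divide_inverse mult.commute)
qed

section \<open>Laplace transforms\<close>

text \<open>The values of the Laplace transform at the integers are the moments of the bounded variable
  \<open>exp (- X)\<close>, which determine its characteristic function.\<close>

lemma (in prob_space) distr_eq_of_laplace_eq:
  fixes X Y :: "'a \<Rightarrow> real"
  assumes X[measurable]: "random_variable borel X" and Y[measurable]: "random_variable borel Y"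
    and X_nonneg: "AE \<omega> in M. 0 \<le> X \<omega>" and Y_nonneg: "AE \<omega> in M. 0 \<le> Y \<omega>"
    and eq: "\<And>u. 0 < u \<Longrightarrow> expectation (\<lambda>\<omega>. exp (- u * X \<omega>)) = expectation (\<lambda>\<omega>. exp (- u * Y \<omega>))"
  shows "distr M borel X = distr M borel Y"
proof -
  \<comment> \<open>Taylor expansion of the characteristic function of \<open>exp (- V)\<close>.
    This variable lies in (0, 1] almost surely, so its moments are at most 1 and the error is at
    most \<open>2 * |t| ^ n / n!\<close>, which tends to 0.\<close>
  have char: "(\<lambda>n. \<Sum>k\<le>n. (\<i> * complex_of_real t) ^ k / fact k * expectation (\<lambda>\<omega>. exp (- V \<omega>) ^ k))
      \<longlonglongrightarrow> char (distr M borel (\<lambda>\<omega>. exp (- V \<omega>))) t"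
    if V[measurable]: "random_variable borel V" and V_nonneg: "AE \<omega> in M. 0 \<le> V \<omega>" for V :: "'a \<Rightarrow> real" and t
  proof -
    have bd: "AE \<omega> in M. \<bar>exp (- V \<omega>) ^ k\<bar> \<le> 1" for k
      using V_nonneg by eventually_elim (simp add: power_le_one)
    have int: "integrable M (\<lambda>\<omega>. exp (- V \<omega>) ^ k)" for k
      using bd by (intro integrable_const_bound[where B=1]) auto
    have le1: "expectation (\<lambda>\<omega>. \<bar>exp (- V \<omega>)\<bar> ^ n) \<le> 1" for n
      using bd[of n] int[of n] integral_le_const[of "\<lambda>\<omega>. exp (- V \<omega>) ^ n" 1] by simp
    show ?thesis
    proof (rule LIM_zero_cancel, rule Lim_null_comparison)
      show "\<forall>\<^sub>F n in sequentially. norm ((\<Sum>k\<le>n. (\<i> * complex_of_real t) ^ k / fact k * expectation (\<lambda>\<omega>. exp (- V \<omega>) ^ k))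
          - char (distr M borel (\<lambda>\<omega>. exp (- V \<omega>))) t) \<le> 2 * \<bar>t\<bar> ^ n / fact n"
      proof (rule always_eventually, rule allI)
        fix n
        have "norm (char (distr M borel (\<lambda>\<omega>. exp (- V \<omega>))) t - (\<Sum>k\<le>n. (\<i> * complex_of_real t) ^ k / fact k * expectation (\<lambda>\<omega>. exp (- V \<omega>) ^ k)))
          \<le> 2 * \<bar>t\<bar> ^ n / fact n * expectation (\<lambda>\<omega>. \<bar>exp (- V \<omega>)\<bar> ^ n)"
          using int by (intro char_approx1') auto
        also have "\<dots> \<le> 2 * \<bar>t\<bar> ^ n / fact n"
          using le1[of n] by (intro mult_left_le) auto
        finally show "norm ((\<Sum>k\<le>n. (\<i> * complex_of_real t) ^ k / fact k * expectation (\<lambda>\<omega>. exp (- V \<omega>) ^ k))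
          - char (distr M borel (\<lambda>\<omega>. exp (- V \<omega>))) t) \<le> 2 * \<bar>t\<bar> ^ n / fact n"
          by (simp add: norm_minus_commute)
      qed
      have "(\<lambda>n. 2 * (\<bar>t\<bar> ^ n / fact n)) \<longlonglongrightarrow> 2 * 0"
        by (intro tendsto_mult tendsto_const) (use summable_LIMSEQ_zero[OF summable_exp, of "\<bar>t\<bar>"] in \<open>simp add: divide_inverse mult.commute\<close>)
      then show "(\<lambda>n. 2 * \<bar>t\<bar> ^ n / fact n) \<longlonglongrightarrow> 0" by simp
    qed
  qed
  \<comment> \<open>The moment of order 0 is treated apart because the transforms are compared only
    for \<open>u > 0\<close>.\<close>
  have moments: "expectation (\<lambda>\<omega>. exp (- X \<omega>) ^ k) = expectation (\<lambda>\<omega>. exp (- Y \<omega>) ^ k)" for k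
    using eq[of "real k"] by (cases "k = 0") (auto simp: exp_of_nat_mult[symmetric])
  have "char (distr M borel (\<lambda>\<omega>. exp (- X \<omega>))) = char (distr M borel (\<lambda>\<omega>. exp (- Y \<omega>)))"
    using char[OF X X_nonneg] char[OF Y Y_nonneg] unfolding moments
    by (intro ext) (rule LIMSEQ_unique)
  then have *: "distr M borel (\<lambda>\<omega>. exp (- X \<omega>)) = distr M borel (\<lambda>\<omega>. exp (- Y \<omega>))"
    by (intro Levy_uniqueness real_distribution_distr) auto
  \<comment> \<open>Equality of laws is carried back from \<open>exp (- V)\<close> to
    \<open>V\<close> by the Borel map \<open>- ln\<close>.\<close>
  have inv: "distr M borel V = distr (distr M borel (\<lambda>\<omega>. exp (- V \<omega>))) borel (\<lambda>y. - ln y)"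
    if "random_variable borel V" for V :: "'a \<Rightarrow> real"
    using that distr_distr[of "\<lambda>y. - ln y" borel borel "\<lambda>\<omega>. exp (- V \<omega>)" M] by (simp add: comp_def)
  show ?thesis
    by (rule trans[OF inv[OF X] trans[OF _ inv[OF Y, symmetric]]]) (simp only: *)
qed

section \<open>Gamma integrals over the half line\<close>

text \<open>The substitution \<open>v = h * u\<close> in Euler's integral. In the form of a
  nonnegative integral it can be inserted under an expectation and the order exchanged by Tonelli's
  theorem without an integrability check.\<close>

lemma nn_integral_Gamma_scaled:
  fixes h p :: real
  assumes h: "h > 0" and p: "p > 0"
  shows "(\<integral>\<^sup>+u. ennreal (indicator {0..} u * u powr (p - 1) * exp (- u * h)) \<partial>lborel)
    = ennreal (Gamma p * h powr (- p))"
proof -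
  define I where "I = (\<integral>\<^sup>+u. ennreal (indicator {0..} u * u powr (p - 1) * exp (- u * h)) \<partial>lborel)"
  have "ennreal (Gamma p) = (\<integral>\<^sup>+u. ennreal (indicator {0..} u * u powr (p - 1) / exp u) \<partial>lborel)"
    using p by (rule Gamma_conv_nn_integral_real)
  also have "\<dots> = ennreal \<bar>h\<bar> * (\<integral>\<^sup>+u. ennreal (indicator {0..} (0 + h * u) * (0 + h * u) powr (p - 1) / exp (0 + h * u)) \<partial>lborel)"
    using h by (intro nn_integral_real_affine) auto
  also have "(\<integral>\<^sup>+u. ennreal (indicator {0..} (0 + h * u) * (0 + h * u) powr (p - 1) / exp (0 + h * u)) \<partial>lborel)
      = (\<integral>\<^sup>+u. ennreal (h powr (p - 1)) * ennreal (indicator {0..} u * u powr (p - 1) * exp (- u * h)) \<partial>lborel)"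
  proof (rule nn_integral_cong)
    fix u :: real
    have "indicator {0..} (0 + h * u) * (0 + h * u) powr (p - 1) / exp (0 + h * u)
      = h powr (p - 1) * (indicator {0..} u * u powr (p - 1) * exp (- u * h))"
      using h by (simp add: indicator_def zero_le_mult_iff powr_mult exp_minus divide_inverse mult.commute)
    then show "ennreal (indicator {0..} (0 + h * u) * (0 + h * u) powr (p - 1) / exp (0 + h * u))
      = ennreal (h powr (p - 1)) * ennreal (indicator {0..} u * u powr (p - 1) * exp (- u * h))"
      by (simp only:) (rule ennreal_mult', simp)
  qed
  also have "\<dots> = ennreal (h powr (p - 1)) * I"
    unfolding I_def by (rule nn_integral_cmult) measurable
  also have "ennreal \<bar>h\<bar> * (ennreal (h powr (p - 1)) * I) = ennreal (h powr p) * I"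
  proof -
    have "\<bar>h\<bar> * h powr (p - 1) = h powr p"
      using h by (simp add: powr_diff)
    then show ?thesis
      by (metis ennreal_mult' abs_ge_zero mult.assoc)
  qed
  finally have *: "ennreal (Gamma p) = ennreal (h powr p) * I" .
  have "ennreal (Gamma p * h powr (- p)) = ennreal (h powr (- p)) * ennreal (Gamma p)"
    by (metis ennreal_mult' mult.commute powr_ge_zero)
  also have "\<dots> = (ennreal (h powr (- p)) * ennreal (h powr p)) * I"
    unfolding * by (rule mult.assoc[symmetric])
  also have "ennreal (h powr (- p)) * ennreal (h powr p) = 1"
  proof -
    have "h powr (- p) * h powr p = 1"
      using h by (simp add: powr_minus)
    then show ?thesis
      by (metis ennreal_1 ennreal_mult' powr_ge_zero)
  qed
  finally show ?thesis
    by (simp add: I_def)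
qed

lemma nn_integral_powr_from_0:
  fixes x p :: real
  assumes "p > 0" "x \<ge> 0"
  shows "(\<integral>\<^sup>+u. ennreal (indicator {0..x} u * u powr (p - 1)) \<partial>lborel) = ennreal (x powr p / p)"
proof -
  have "((\<lambda>u. u powr (p - 1)) has_integral (x powr (p - 1 + 1) / (p - 1 + 1))) {0..x}"
    using assms by (intro has_integral_powr_from_0) auto
  from nn_integral_has_integral_lebesgue[OF _ this] show ?thesis
    by simp
qed

text \<open>Writing \<open>exp (- u powr \<alpha>)\<close> as the integral of \<open>exp (- v)\<close> over \<open>v \<ge> u powr \<alpha>\<close> and
  exchanging the integrals avoids a change of variables on a half line.\<close>

lemma nn_integral_powr_exp_powr:
  fixes \<alpha> :: real
  assumes \<alpha>: "\<alpha> > 0" and p: "p > 0"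
  shows "(\<integral>\<^sup>+u. ennreal (indicator {0..} u * u powr (p - 1) * exp (- (u powr \<alpha>))) \<partial>lborel)
    = ennreal (Gamma (p / \<alpha> + 1) / p)"
proof -
  have exp_tail: "ennreal (exp (- a)) = (\<integral>\<^sup>+v. ennreal (indicator {a..} v * exp (- v)) \<partial>lborel)" for a :: real
  proof -
    have "((\<lambda>v. exp (- 1 * v)) has_integral exp (- 1 * a) / 1) {a..}"
      by (intro has_integral_exp_minus_to_infinity) auto
    from nn_integral_has_integral_lebesgue[OF _ this] show ?thesis by simp
  qed
  have "(\<integral>\<^sup>+u. ennreal (indicator {0..} u * u powr (p - 1) * exp (- (u powr \<alpha>))) \<partial>lborel)
    = (\<integral>\<^sup>+u. (\<integral>\<^sup>+v. ennreal (indicator {0..} u * u powr (p - 1)) * ennreal (indicator {u powr \<alpha>..} v * exp (- v)) \<partial>lborel) \<partial>lborel)"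
    by (intro nn_integral_cong, subst nn_integral_cmult) (simp_all add: exp_tail[symmetric] ennreal_mult'[symmetric] del: ennreal_mult')
  also have "\<dots> = (\<integral>\<^sup>+v. (\<integral>\<^sup>+u. ennreal (indicator {0..} u * u powr (p - 1)) * ennreal (indicator {u powr \<alpha>..} v * exp (- v)) \<partial>lborel) \<partial>lborel)"
  proof (rule lborel_pair.Fubini'[symmetric])
    \<comment> \<open>The indicator of a set depending on \<open>u\<close> is written as a
      conditional, which makes joint measurability in \<open>(u, v)\<close> visible.\<close>
    have "(\<lambda>(u::real, v). ennreal (indicator {0..} u * u powr (p - 1)) * ennreal ((if u powr \<alpha> \<le> v then 1 else 0) * exp (- v)))
      \<in> borel_measurable (borel \<Otimes>\<^sub>M borel)" by measurable
    also have "(\<lambda>(u::real, v). ennreal (indicator {0..} u * u powr (p - 1)) * ennreal ((if u powr \<alpha> \<le> v then 1 else 0) * exp (- v)))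
      = (\<lambda>(u, v). ennreal (indicator {0..} u * u powr (p - 1)) * ennreal (indicator {u powr \<alpha>..} v * exp (- v)))"
      by (auto simp: fun_eq_iff indicator_def)
    finally show "(\<lambda>(u, v). ennreal (indicator {0..} u * u powr (p - 1)) * ennreal (indicator {u powr \<alpha>..} v * exp (- v)))
        \<in> borel_measurable (lborel \<Otimes>\<^sub>M lborel)"
      by (simp cong: measurable_cong_sets sets_pair_measure_cong)
  qed
  \<comment> \<open>For fixed \<open>v >= 0\<close> the variable \<open>u\<close> ranges over
    \<open>[0, v powr (1 / \<alpha>)]\<close>, which contributes
    \<open>v powr (p / \<alpha>) / p\<close>. What remains is Euler's integral for
    \<open>p / \<alpha> + 1\<close>.\<close>
  also have "\<dots> = (\<integral>\<^sup>+v. ennreal (1 / p) * ennreal (indicator {0..} v * v powr (p / \<alpha> + 1 - 1) / exp v) \<partial>lborel)"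
  proof (rule nn_integral_cong)
    fix v :: real
    have le_iff: "u powr \<alpha> \<le> v \<longleftrightarrow> u \<le> v powr (1 / \<alpha>)" if "u \<ge> 0" "v \<ge> 0" for u
      using that \<alpha> powr_mono2[of "1 / \<alpha>" "u powr \<alpha>" v] powr_mono2[of \<alpha> u "v powr (1 / \<alpha>)"]
      by (auto simp: powr_powr)
    show "(\<integral>\<^sup>+u. ennreal (indicator {0..} u * u powr (p - 1)) * ennreal (indicator {u powr \<alpha>..} v * exp (- v)) \<partial>lborel)
      = ennreal (1 / p) * ennreal (indicator {0..} v * v powr (p / \<alpha> + 1 - 1) / exp v)"
    proof (cases "v \<ge> 0")
      case True
      have "(\<integral>\<^sup>+u. ennreal (indicator {0..} u * u powr (p - 1)) * ennreal (indicator {u powr \<alpha>..} v * exp (- v)) \<partial>lborel)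
        = (\<integral>\<^sup>+u. ennreal (exp (- v)) * ennreal (indicator {0..v powr (1 / \<alpha>)} u * u powr (p - 1)) \<partial>lborel)"
        using le_iff True by (intro nn_integral_cong) (auto simp: indicator_def mult.commute)
      also have "\<dots> = ennreal (exp (- v)) * ennreal ((v powr (1 / \<alpha>)) powr p / p)"
        using p by (subst nn_integral_cmult) (auto simp: nn_integral_powr_from_0)
      finally show ?thesis
        using True p by (simp add: powr_powr ennreal_mult'[symmetric] exp_minus field_simps)
    next
      case False
      \<comment> \<open>A value of \<open>powr\<close> is never negative, so no \<open>u\<close>
        contributes when \<open>v < 0\<close>.\<close>
      then have "\<not> u powr \<alpha> \<le> v" for u
        using powr_ge_zero[of u \<alpha>] by linarith
      with False show ?thesis by simp
    qed
  qed
  also have "\<dots> = ennreal (1 / p) * ennreal (Gamma (p / \<alpha> + 1))"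
    using p \<alpha> by (subst nn_integral_cmult) (simp_all only: Gamma_conv_nn_integral_real divide_pos_pos add_pos_pos zero_less_one, measurable)
  finally show ?thesis
    using p by (simp add: ennreal_mult'[symmetric])
qed

section \<open>Positivity, tails and negative moments from the Laplace transform\<close>

text \<open>On \<open>{X = 0}\<close> the integrand is 1 for every \<open>u\<close>, so the
  transform never falls below the probability of that event.\<close>

lemma (in prob_space) AE_pos_of_laplace_tendsto_0:
  fixes X :: "'a \<Rightarrow> real"
  assumes X[measurable]: "random_variable borel X" and nonneg: "AE \<omega> in M. 0 \<le> X \<omega>"
    and lim: "((\<lambda>u. expectation (\<lambda>\<omega>. exp (- u * X \<omega>))) \<longlongrightarrow> 0) at_top"
  shows "AE \<omega> in M. 0 < X \<omega>"
proof -
  have "prob {\<omega> \<in> space M. X \<omega> = 0} \<le> expectation (\<lambda>\<omega>. exp (- u * X \<omega>))" if "u > 0" for u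
  proof -
    have "expectation (indicator {\<omega> \<in> space M. X \<omega> = 0}) \<le> expectation (\<lambda>\<omega>. exp (- u * X \<omega>))"
    proof (rule integral_mono_AE)
      show "integrable M (\<lambda>\<omega>. exp (- u * X \<omega>))"
        using nonneg that by (intro integrable_const_bound[where B=1]) auto
      show "AE \<omega> in M. indicator {\<omega> \<in> space M. X \<omega> = 0} \<omega> \<le> exp (- u * X \<omega>)"
        by (auto simp: indicator_def)
    qed (auto intro!: integrable_real_indicator simp: emeasure_eq_measure)
    then show ?thesis by simp
  qed
  then have "prob {\<omega> \<in> space M. X \<omega> = 0} \<le> 0"
    by (intro tendsto_lowerbound[OF lim]) (auto intro: eventually_mono[OF eventually_gt_at_top[of 0]])
  then have "prob {\<omega> \<in> space M. X \<omega> = 0} = 0"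
    using measure_nonneg[of M "{\<omega> \<in> space M. X \<omega> = 0}"] by linarith
  then have "AE \<omega> in M. X \<omega> \<noteq> 0"
    by (intro AE_I[of _ _ "{\<omega> \<in> space M. X \<omega> = 0}"]) (auto simp: emeasure_eq_measure)
  with nonneg show ?thesis by eventually_elim simp
qed

text \<open>Chernoff bound: where \<open>X < t\<close>, \<open>exp (t - X)\<close> exceeds
  1.\<close>

lemma (in prob_space) laplace_tail_bound:
  fixes X :: "'a \<Rightarrow> real"
  assumes X[measurable]: "random_variable borel X" and nonneg: "AE \<omega> in M. 0 \<le> X \<omega>"
  shows "prob {\<omega> \<in> space M. X \<omega> < t} \<le> exp t * expectation (\<lambda>\<omega>. exp (- X \<omega>))"
proof -
  have int: "integrable M (\<lambda>\<omega>. exp (- X \<omega>))"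
    using nonneg by (intro integrable_const_bound[where B=1]) auto
  have "expectation (indicator {\<omega> \<in> space M. X \<omega> < t}) \<le> expectation (\<lambda>\<omega>. exp t * exp (- X \<omega>))"
  proof (rule integral_mono)
    show "integrable M (\<lambda>\<omega>. exp t * exp (- X \<omega>))"
      using int by simp
    show "indicator {\<omega> \<in> space M. X \<omega> < t} \<omega> \<le> exp t * exp (- X \<omega>)" for \<omega>
      by (auto simp: indicator_def exp_minus divide_inverse[symmetric] pos_le_divide_eq)
  qed (auto intro!: integrable_real_indicator simp: emeasure_eq_measure)
  then show ?thesis by simp
qed

text \<open>The Gamma integral for \<open>X powr (- p)\<close> and Tonelli's theorem turn the moment
  into an integral of the Laplace transform against \<open>u powr (p - 1)\<close>. As an identity of
  nonnegative integrals it includes finiteness of the moment.\<close>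

lemma (in prob_space) moment_powr_of_stable_laplace:
  fixes X :: "'a \<Rightarrow> real"
  assumes \<alpha>: "\<alpha> > 0" and p: "p > 0"
    and X[measurable]: "random_variable borel X" and pos: "AE \<omega> in M. 0 < X \<omega>"
    and laplace: "\<And>u. 0 < u \<Longrightarrow> expectation (\<lambda>\<omega>. exp (- u * X \<omega>)) = exp (- (u powr \<alpha>))"
  shows "(\<integral>\<^sup>+\<omega>. ennreal (X \<omega> powr (- p)) \<partial>M) = ennreal (Gamma (p / \<alpha> + 1) / Gamma (p + 1))"
proof -
  have G: "Gamma p > 0" "Gamma (p + 1) = p * Gamma p"
    using p Gamma_plus1[of p] nonpos_Ints_nonpos[of p] by force+
  have "ennreal (Gamma p) * (\<integral>\<^sup>+\<omega>. ennreal (X \<omega> powr (- p)) \<partial>M)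
      = (\<integral>\<^sup>+\<omega>. ennreal (Gamma p * X \<omega> powr (- p)) \<partial>M)"
    using G by (subst nn_integral_cmult[symmetric]) (auto simp: ennreal_mult')
  also have "\<dots> = (\<integral>\<^sup>+\<omega>. (\<integral>\<^sup>+u. ennreal (indicator {0..} u * u powr (p - 1) * exp (- u * X \<omega>)) \<partial>lborel) \<partial>M)"
  proof (rule nn_integral_cong_AE)
    show "AE \<omega> in M. ennreal (Gamma p * X \<omega> powr (- p)) =
        (\<integral>\<^sup>+u. ennreal (indicator {0..} u * u powr (p - 1) * exp (- u * X \<omega>)) \<partial>lborel)"
      using pos by eventually_elim (rule nn_integral_Gamma_scaled[OF _ p, symmetric])
  qed
  also have "\<dots> = (\<integral>\<^sup>+u. (\<integral>\<^sup>+\<omega>. ennreal (indicator {0..} u * u powr (p - 1) * exp (- u * X \<omega>)) \<partial>M) \<partial>lborel)"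
  proof -
    interpret P: pair_sigma_finite M lborel ..
    show ?thesis by (rule P.Fubini'[symmetric]) measurable
  qed
  also have "\<dots> = (\<integral>\<^sup>+u. ennreal (indicator {0..} u * u powr (p - 1) * exp (- (u powr \<alpha>))) \<partial>lborel)"
  \<comment> \<open>The point \<open>u = 0\<close> is discarded as a null set, the transform being
    given only for \<open>u > 0\<close>; for negative \<open>u\<close> the indicator
    vanishes.\<close>
  proof (rule nn_integral_cong_AE, rule AE_mp[OF AE_lborel_singleton[of 0]], rule AE_I2, rule impI)
    fix u :: real
    assume "u \<noteq> 0"
    show "(\<integral>\<^sup>+\<omega>. ennreal (indicator {0..} u * u powr (p - 1) * exp (- u * X \<omega>)) \<partial>M)
      = ennreal (indicator {0..} u * u powr (p - 1) * exp (- (u powr \<alpha>)))"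
    proof (cases "u > 0")
      case True
      have int: "integrable M (\<lambda>\<omega>. exp (- u * X \<omega>))"
        using pos True by (intro integrable_const_bound[where B=1]) auto
      have "(\<integral>\<^sup>+\<omega>. ennreal (indicator {0..} u * u powr (p - 1) * exp (- u * X \<omega>)) \<partial>M)
          = ennreal (indicator {0..} u * u powr (p - 1)) * (\<integral>\<^sup>+\<omega>. ennreal (exp (- u * X \<omega>)) \<partial>M)"
        by (subst nn_integral_cmult[symmetric]) (auto simp: ennreal_mult')
      also have "(\<integral>\<^sup>+\<omega>. ennreal (exp (- u * X \<omega>)) \<partial>M) = ennreal (exp (- (u powr \<alpha>)))"
        using int laplace[OF True] by (subst nn_integral_eq_integral) auto
      finally show ?thesis by (simp add: ennreal_mult')
    next
      case False
      with \<open>u \<noteq> 0\<close> show ?thesis by simp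
    qed
  qed
  also have "\<dots> = ennreal (Gamma (p / \<alpha> + 1) / p)"
    using \<alpha> p by (rule nn_integral_powr_exp_powr)
  finally have *: "ennreal (Gamma p) * (\<integral>\<^sup>+\<omega>. ennreal (X \<omega> powr (- p)) \<partial>M) = ennreal (Gamma (p / \<alpha> + 1) / p)" .
  have "ennreal (1 / Gamma p) * ennreal (Gamma p) = 1"
  proof -
    have "1 / Gamma p * Gamma p = 1" using G by simp
    then show ?thesis
      using G by (metis ennreal_1 ennreal_mult' divide_nonneg_pos zero_le_one)
  qed
  then have "(\<integral>\<^sup>+\<omega>. ennreal (X \<omega> powr (- p)) \<partial>M) = ennreal (1 / Gamma p) * ennreal (Gamma (p / \<alpha> + 1) / p)"
    unfolding *[symmetric] by (simp add: mult.assoc[symmetric])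
  also have "\<dots> = ennreal (1 / Gamma p * (Gamma (p / \<alpha> + 1) / p))"
    using G by (intro ennreal_mult'[symmetric]) auto
  finally show ?thesis
    using G by (simp add: mult.commute)
qed

text \<open>The moments of order \<open>p = k * \<alpha>\<close> carry a factor \<open>k!\<close>
  that cancels the one in the exponential series and leaves the Mittag-Leffler series. That series
  converges absolutely everywhere, so summation and expectation may be exchanged for every real
  \<open>c\<close>.\<close>

lemma (in prob_space) laplace_power_of_stable_laplace:
  fixes X :: "'a \<Rightarrow> real"
  assumes \<alpha>: "\<alpha> > 0" and t: "t \<ge> 0"
    and X[measurable]: "random_variable borel X" and pos: "AE \<omega> in M. 0 < X \<omega>"
    and laplace: "\<And>u. 0 < u \<Longrightarrow> expectation (\<lambda>\<omega>. exp (- u * X \<omega>)) = exp (- (u powr \<alpha>))"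
  shows "expectation (\<lambda>\<omega>. exp (- c * (t / X \<omega>) powr \<alpha>)) = mittag_leffler \<alpha> (- c * t powr \<alpha>)"
proof -
  define V where "V \<omega> = (t / X \<omega>) powr \<alpha>" for \<omega>
  have V[measurable]: "random_variable borel V" by (simp add: V_def[abs_def])
  have V_nonneg: "V \<omega> \<ge> 0" for \<omega> by (simp add: V_def)
  have Gpos: "Gamma (real k * \<alpha> + 1) > 0" for k
    using \<alpha> by (intro Gamma_real_pos) (simp add: add_nonneg_pos)
  \<comment> \<open>Order 0 is separate because the moment formula requires
    \<open>p > 0\<close>.\<close>
  have nn: "(\<integral>\<^sup>+\<omega>. ennreal (V \<omega> ^ k) \<partial>M) = ennreal ((t powr \<alpha>) ^ k * fact k / Gamma (real k * \<alpha> + 1))" for k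
  proof (cases "k = 0")
    case True
    then show ?thesis by (simp add: emeasure_space_1)
  next
    case False
    then have p: "real k * \<alpha> > 0" using \<alpha> by simp
    have "(\<integral>\<^sup>+\<omega>. ennreal (V \<omega> ^ k) \<partial>M) = (\<integral>\<^sup>+\<omega>. ennreal ((t powr \<alpha>) ^ k) * ennreal (X \<omega> powr (- (real k * \<alpha>))) \<partial>M)"
    proof (rule nn_integral_cong_AE)
      show "AE \<omega> in M. ennreal (V \<omega> ^ k) = ennreal ((t powr \<alpha>) ^ k) * ennreal (X \<omega> powr (- (real k * \<alpha>)))"
        using pos
      proof eventually_elim
        case (elim \<omega>)
        have "V \<omega> ^ k = (t powr \<alpha>) ^ k / (X \<omega> powr \<alpha>) ^ k"
          using elim t by (simp add: V_def powr_divide power_divide)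
        also have "(X \<omega> powr \<alpha>) ^ k = X \<omega> powr (real k * \<alpha>)"
          using elim by (simp add: powr_realpow[symmetric] powr_powr mult.commute)
        finally show ?case
          by (simp add: powr_minus divide_inverse ennreal_mult')
      qed
    qed
    also have "\<dots> = ennreal ((t powr \<alpha>) ^ k) * ennreal (Gamma (real k * \<alpha> / \<alpha> + 1) / Gamma (real k * \<alpha> + 1))"
      using moment_powr_of_stable_laplace[OF \<alpha> p X pos laplace] by (subst nn_integral_cmult) auto
    also have "Gamma (real k * \<alpha> / \<alpha> + 1) = fact k"
      using \<alpha> by (simp add: Gamma_fact add.commute)
    finally show ?thesis
      by (simp add: ennreal_mult'[symmetric])
  qed
  have V_int: "integrable M (\<lambda>\<omega>. V \<omega> ^ k)" for k
    using nn[of k] V_nonneg by (intro integrableI_nonneg) auto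
  have V_moment: "expectation (\<lambda>\<omega>. V \<omega> ^ k) = (t powr \<alpha>) ^ k * fact k / Gamma (real k * \<alpha> + 1)" for k
    using nn[of k] V_nonneg Gpos[of k] by (intro integral_eq_nn_integral[THEN trans]) auto
  define f where "f k \<omega> = (- c) ^ k / fact k * V \<omega> ^ k" for k \<omega>
  have norm_f: "norm (f k \<omega>) = \<bar>c\<bar> ^ k / fact k * V \<omega> ^ k" for k \<omega>
    using V_nonneg[of \<omega>] by (simp add: f_def abs_mult power_abs)
  have f_int: "integrable M (f k)" for k
    using V_int by (simp add: f_def[abs_def])
  have f_eq: "expectation (f k) = (- c * t powr \<alpha>) ^ k / Gamma (real k * \<alpha> + 1)" for k
  proof -
    have "expectation (f k) = (- c) ^ k / fact k * expectation (\<lambda>\<omega>. V \<omega> ^ k)"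
      by (simp add: f_def[abs_def])
    also have "\<dots> = (- c) ^ k * (t powr \<alpha>) ^ k / Gamma (real k * \<alpha> + 1)"
      by (simp add: V_moment)
    finally show ?thesis unfolding power_mult_distrib .
  qed
  have f_norm_eq: "expectation (\<lambda>\<omega>. norm (f k \<omega>)) = (\<bar>c\<bar> * t powr \<alpha>) ^ k / Gamma (real k * \<alpha> + 1)" for k
    by (simp only: norm_f) (simp add: V_moment power_mult_distrib)
  have f_sums: "(\<lambda>k. f k \<omega>) sums exp (- c * V \<omega>)" for \<omega>
    using exp_converges[of "- c * V \<omega>"] unfolding power_mult_distrib
    by (simp add: f_def divide_inverse mult_ac)
  have "(\<lambda>k. expectation (f k)) sums expectation (\<lambda>\<omega>. \<Sum>k. f k \<omega>)"
  proof (rule sums_integral)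
    show "AE \<omega> in M. summable (\<lambda>k. norm (f k \<omega>))"
    proof (rule AE_I2)
      fix \<omega>
      show "summable (\<lambda>k. norm (f k \<omega>))"
        unfolding norm_f using summable_exp[of "\<bar>c\<bar> * V \<omega>"] by (simp add: power_mult_distrib divide_inverse mult.commute mult.left_commute)
    qed
    show "summable (\<lambda>k. expectation (\<lambda>\<omega>. norm (f k \<omega>)))"
      unfolding f_norm_eq using \<alpha> by (rule summable_mittag_leffler)
  qed (rule f_int)
  then show ?thesis
    unfolding f_eq sums_unique[OF f_sums, symmetric]
    by (simp add: mittag_leffler_def sums_iff V_def)
qed

section \<open>Inverse stable subordinators\<close>

text \<open>Right-continuity puts the infimum itself into the level set, and monotonicity makes that
  set closed upwards. The point \<open>r\<close> witnesses that the set is nonempty.\<close>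

lemma Inf_upper_level_set_le_iff:
  fixes f :: "real \<Rightarrow> real"
  assumes mono: "mono_on {0..} f" and rc: "\<And>s. 0 \<le> s \<Longrightarrow> continuous (at_right s) f"
    and r: "0 \<le> r" "t \<le> f r" and s: "0 \<le> s"
  shows "Inf {s. 0 \<le> s \<and> t \<le> f s} \<le> s \<longleftrightarrow> t \<le> f s"
proof -
  define S where "S = {s. 0 \<le> s \<and> t \<le> f s}"
  have S: "S \<noteq> {}" "bdd_below S"
    using r by (auto simp: S_def intro: bdd_belowI[of _ 0])
  have Inf_nonneg: "0 \<le> Inf S"
    using S by (intro cInf_greatest) (auto simp: S_def)
  have "t \<le> f (Inf S)"
  proof (rule tendsto_lowerbound)
    show "(f \<longlongrightarrow> f (Inf S)) (at_right (Inf S))"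
      using rc[OF Inf_nonneg] by (simp add: continuous_within)
    \<comment> \<open>Every point to the right of the infimum exceeds some element of the level set,
      hence belongs to it by monotonicity.\<close>
    show "\<forall>\<^sub>F x in at_right (Inf S). t \<le> f x"
      unfolding eventually_at_right_field
    proof (intro exI[of _ "Inf S + 1"] conjI allI impI)
      fix y assume "Inf S < y"
      with S obtain x where x: "x \<in> S" "x < y"
        by (meson cInf_less_iff)
      then have "t \<le> f x" "f x \<le> f y"
        by (auto simp: S_def intro!: mono_onD[OF mono])
      then show "t \<le> f y" by simp
    qed simp
  qed simp
  then have "Inf S \<le> s \<Longrightarrow> t \<le> f s"
    using mono_onD[OF mono, of "Inf S" s] Inf_nonneg s by fastforce
  moreover have "t \<le> f s \<Longrightarrow> Inf S \<le> s"
    using S s by (intro cInf_lower) (auto simp: S_def)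
  ultimately show ?thesis by (auto simp: S_def)
qed

text \<open>Both conclusions rest on the fact that \<open>H\<close> almost surely reaches the level
  \<open>t\<close>; otherwise \<open>L t\<close> would be the infimum of the empty set. They are
  therefore proved together.\<close>

lemma (in prob_space) inverse_stable_subordinator_nonneg_and_laplace:
  assumes \<alpha>: "0 < \<alpha>" and L: "inverse_stable_subordinator M \<alpha> L" and t: "0 \<le> t"
  shows "AE \<omega> in M. 0 \<le> L t \<omega>"
    and "expectation (\<lambda>\<omega>. exp (- c * L t \<omega>)) = mittag_leffler \<alpha> (- c * t powr \<alpha>)"
proof -
  obtain H where H: "stable_subordinator M \<alpha> H"
    and L_Inf: "AE \<omega> in M. \<forall>t\<ge>0. L t \<omega> = Inf {s. 0 \<le> s \<and> t \<le> H s \<omega>}"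
    using L by (auto simp: inverse_stable_subordinator_def)
  have L_meas[measurable]: "random_variable borel (L t)"
    using L t by (auto simp: inverse_stable_subordinator_def)
  have H_meas: "random_variable borel (H s)" if "0 \<le> s" for s
    using H that by (auto simp: stable_subordinator_def levy_process_def)
  have H_mono: "AE \<omega> in M. mono_on {0..} (\<lambda>s. H s \<omega>)"
    and H_0: "AE \<omega> in M. H 0 \<omega> = 0"
    and H_cadlag: "AE \<omega> in M. (\<forall>t\<ge>0. continuous (at_right t) (\<lambda>s. H s \<omega>)) \<and>
                 (\<forall>t>0. \<exists>l. ((\<lambda>s. H s \<omega>) \<longlongrightarrow> l) (at_left t))"
    using H by (auto simp: stable_subordinator_def levy_process_def)
  have H_laplace: "expectation (\<lambda>\<omega>. exp (- u * H s \<omega>)) = exp (- s * u powr \<alpha>)" if "0 \<le> s" "0 < u" for s u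
    using H that by (auto simp: stable_subordinator_def)
  have H_nonneg: "AE \<omega> in M. 0 \<le> H s \<omega>" if "0 \<le> s" for s
    using H_mono H_0
  proof eventually_elim
    case (elim \<omega>)
    then show ?case using mono_onD[of "{0..}" "\<lambda>s. H s \<omega>" 0 s] that by simp
  qed

  have H_unbounded: "AE \<omega> in M. \<exists>n::nat. t \<le> H (real n) \<omega>"
  proof -
    have [measurable]: "random_variable borel (H (real n))" for n by (intro H_meas) simp
    \<comment> \<open>Sampling the path at the integers keeps the event measurable. The tail bound
      with the transform at \<open>u = 1\<close> gives \<open>exp (t - n)\<close> for each
      \<open>n\<close>, so the event is null.\<close>
    define B where "B = {\<omega> \<in> space M. \<forall>n::nat. H (real n) \<omega> < t}"
    have [measurable]: "B \<in> events" unfolding B_def by measurable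
    have "prob B \<le> exp t * exp (- real n)" for n
    proof -
      have "prob B \<le> prob {\<omega> \<in> space M. H (real n) \<omega> < t}"
        by (intro finite_measure_mono) (auto simp: B_def)
      also have "\<dots> \<le> exp t * expectation (\<lambda>\<omega>. exp (- H (real n) \<omega>))"
        by (intro laplace_tail_bound H_meas H_nonneg) auto
      finally show ?thesis using H_laplace[of "real n" 1] by simp
    qed
    moreover have "(\<lambda>n. exp t * exp (- real n)) \<longlonglongrightarrow> exp t * 0"
      by (intro tendsto_mult tendsto_const filterlim_compose[OF exp_at_bot]
          filterlim_compose[OF filterlim_uminus_at_bot_at_top filterlim_real_sequentially])
    ultimately have "prob B \<le> 0"
      by (intro LIMSEQ_le_const[where X="\<lambda>n. exp t * exp (- real n)"]) auto
    then have "prob B = 0"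
      using measure_nonneg[of M B] by linarith
    then show ?thesis
      by (intro AE_I[of _ _ B]) (auto simp: B_def emeasure_eq_measure not_less[symmetric])
  qed

  have L_le_iff: "AE \<omega> in M. \<forall>s\<ge>0. L t \<omega> \<le> s \<longleftrightarrow> t \<le> H s \<omega>"
    using L_Inf H_mono H_cadlag H_unbounded
  proof eventually_elim
    case (elim \<omega>)
    then obtain n :: nat where "t \<le> H (real n) \<omega>" by blast
    then show ?case
      using elim t Inf_upper_level_set_le_iff[of "\<lambda>s. H s \<omega>" "real n" t] by auto
  qed
  show L_nonneg: "AE \<omega> in M. 0 \<le> L t \<omega>"
    using L_Inf H_unbounded
  proof eventually_elim
    case (elim \<omega>)
    then obtain n :: nat where "t \<le> H (real n) \<omega>" by blast
    then have "real n \<in> {s. 0 \<le> s \<and> t \<le> H s \<omega>}" by simp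
    then show ?case using elim t
      by (auto intro!: cInf_greatest)
  qed

  have H1[measurable]: "random_variable borel (H 1)" by (intro H_meas) simp
  have H1_laplace: "expectation (\<lambda>\<omega>. exp (- u * H 1 \<omega>)) = exp (- (u powr \<alpha>))" if "0 < u" for u
    using H_laplace[of 1 u] that by simp
  have H1_pos: "AE \<omega> in M. 0 < H 1 \<omega>"
  \<comment> \<open>Since \<open>u powr \<alpha>\<close> grows without bound, the transform of
    \<open>H 1\<close> tends to 0. This excludes an atom at 0, so that dividing by
    \<open>H 1\<close> is legitimate.\<close>
  proof (rule AE_pos_of_laplace_tendsto_0[OF H1 H_nonneg])
    have "((\<lambda>u. exp (- exp (\<alpha> * ln u))) \<longlongrightarrow> 0) at_top"
      by (intro filterlim_compose[OF exp_at_bot] filterlim_compose[OF filterlim_uminus_at_bot_at_top]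
          filterlim_compose[OF exp_at_top] filterlim_tendsto_pos_mult_at_top[OF tendsto_const \<alpha>] ln_at_top)
    then show "((\<lambda>u. expectation (\<lambda>\<omega>. exp (- u * H 1 \<omega>))) \<longlongrightarrow> 0) at_top"
    proof (rule Lim_transform_eventually)
      show "\<forall>\<^sub>F u in at_top. exp (- exp (\<alpha> * ln u)) = expectation (\<lambda>\<omega>. exp (- u * H 1 \<omega>))"
        using eventually_gt_at_top[of 0] by eventually_elim (simp add: H1_laplace[simplified] powr_def)
    qed
  qed simp

  \<comment> \<open>Both sides have Laplace transform \<open>exp (- s * u powr \<alpha>)\<close>.
    For \<open>s = 0\<close> the transform of \<open>H 1\<close> would be evaluated at 0, outside
    its given range; both variables are then almost surely 0.\<close>
  have self_similar: "distr M borel (H s) = distr M borel (\<lambda>\<omega>. s powr (1 / \<alpha>) * H 1 \<omega>)" if s: "0 \<le> s" for s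
  proof (rule distr_eq_of_laplace_eq)
    show "AE \<omega> in M. 0 \<le> s powr (1 / \<alpha>) * H 1 \<omega>"
      using H1_pos by eventually_elim simp
    fix u :: real
    assume u: "0 < u"
    show "expectation (\<lambda>\<omega>. exp (- u * H s \<omega>)) = expectation (\<lambda>\<omega>. exp (- u * (s powr (1 / \<alpha>) * H 1 \<omega>)))"
    proof (cases "s = 0")
      case True
      then show ?thesis using H_laplace[of 0 u] u by (simp add: prob_space)
    next
      case False
      then have "0 < u * s powr (1 / \<alpha>)" using s u by simp
      from H1_laplace[OF this] show ?thesis
        using H_laplace[OF s u] s u \<alpha> by (simp add: powr_mult powr_powr mult_ac)
    qed
  qed (auto intro!: H_meas H_nonneg s)

  define X where "X \<omega> = (t / H 1 \<omega>) powr \<alpha>" for \<omega>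
  have [measurable]: "random_variable borel X" by (simp add: X_def[abs_def])
  \<comment> \<open>The distribution functions are compared: for \<open>s >= 0\<close> by inverting
    \<open>H\<close> and scaling to \<open>H 1\<close>, for \<open>s < 0\<close> because both
    variables are almost surely nonnegative.\<close>
  have "distr M borel (L t) = distr M borel X"
  proof (rule cdf_unique)
    show "cdf (distr M borel (L t)) = cdf (distr M borel X)"
    proof
      fix s :: real
      show "cdf (distr M borel (L t)) s = cdf (distr M borel X) s"
      proof (cases "0 \<le> s")
        case True
        have [measurable]: "random_variable borel (H s)" by (rule H_meas[OF True])
        have "cdf (distr M borel (L t)) s = prob {\<omega> \<in> space M. L t \<omega> \<le> s}"
          by (simp add: cdf_def measure_distr vimage_def Int_def conj_commute)
        also have "\<dots> = prob {\<omega> \<in> space M. t \<le> H s \<omega>}"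
          using L_le_iff True by (intro finite_measure_eq_AE) auto
        also have "\<dots> = measure (distr M borel (H s)) {t..}"
          by (simp add: measure_distr vimage_def Int_def conj_commute)
        also have "\<dots> = prob {\<omega> \<in> space M. t \<le> s powr (1 / \<alpha>) * H 1 \<omega>}"
          unfolding self_similar[OF True] by (simp add: measure_distr vimage_def Int_def conj_commute)
        also have "\<dots> = prob {\<omega> \<in> space M. X \<omega> \<le> s}"
        proof (rule finite_measure_eq_AE)
          show "AE \<omega> in M. \<omega> \<in> {\<omega> \<in> space M. t \<le> s powr (1 / \<alpha>) * H 1 \<omega>} \<longleftrightarrow> \<omega> \<in> {\<omega> \<in> space M. X \<omega> \<le> s}"
            using H1_pos
          proof eventually_elim
            case (elim \<omega>)
            have "t \<le> s powr (1 / \<alpha>) * H 1 \<omega> \<longleftrightarrow> t / H 1 \<omega> \<le> s powr (1 / \<alpha>)"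
              using elim by (simp add: pos_divide_le_eq)
            also have "\<dots> \<longleftrightarrow> X \<omega> \<le> s"
              using powr_mono2[of \<alpha> "t / H 1 \<omega>" "s powr (1 / \<alpha>)"]
                powr_mono2[of "1 / \<alpha>" "(t / H 1 \<omega>) powr \<alpha>" s] True t elim \<alpha>
              by (auto simp: X_def powr_powr)
            finally show ?case by simp
          qed
        qed auto
        also have "\<dots> = cdf (distr M borel X) s"
          by (simp add: cdf_def measure_distr vimage_def Int_def conj_commute)
        finally show ?thesis .
      next
        case False
        have "cdf (distr M borel Y) s = 0"
          if [measurable]: "random_variable borel Y" and nonneg: "AE \<omega> in M. 0 \<le> Y \<omega>" for Y
        proof -
          have "cdf (distr M borel Y) s = prob {\<omega> \<in> space M. Y \<omega> \<le> s}"
            by (simp add: cdf_def measure_distr vimage_def Int_def conj_commute)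
          also have "\<dots> = prob {}"
          proof (rule finite_measure_eq_AE)
            show "AE \<omega> in M. \<omega> \<in> {\<omega> \<in> space M. Y \<omega> \<le> s} \<longleftrightarrow> \<omega> \<in> {}"
              using nonneg False by (auto elim!: eventually_mono)
          qed auto
          finally show ?thesis by simp
        qed
        from this[OF L_meas L_nonneg] this[of X] show ?thesis
          by (simp add: X_def)
      qed
    qed
  qed (auto intro!: real_distribution_distr)
  moreover have "expectation (\<lambda>\<omega>. exp (- c * Y \<omega>)) = integral\<^sup>L (distr M borel Y) (\<lambda>x. exp (- c * x))"
    if "random_variable borel Y" for Y
    using that by (simp add: integral_distr)
  ultimately have "expectation (\<lambda>\<omega>. exp (- c * L t \<omega>)) = expectation (\<lambda>\<omega>. exp (- c * X \<omega>))"
    by simp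
  also have "\<dots> = mittag_leffler \<alpha> (- c * t powr \<alpha>)"
    unfolding X_def using \<alpha> t H1 H1_pos H1_laplace by (rule laplace_power_of_stable_laplace)
  finally show "expectation (\<lambda>\<omega>. exp (- c * L t \<omega>)) = mittag_leffler \<alpha> (- c * t powr \<alpha>)" .
qed

section \<open>Random indices and random times\<close>

text \<open>On the event \<open>K = k\<close> the composed variable is \<open>V k\<close>, and the
  indicator of that event is independent of \<open>V k\<close>, so the expectation factors there.
  The variables \<open>V k\<close> may depend on one another, as partial sums and the values of one
  process do.\<close>

lemma (in prob_space) char_random_index:
  fixes K :: "'a \<Rightarrow> nat" and V :: "nat \<Rightarrow> 'a \<Rightarrow> real" and \<psi> :: "nat \<Rightarrow> complex"
  assumes K[measurable]: "K \<in> measurable M (count_space UNIV)"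
    and V[measurable]: "\<And>k. random_variable borel (V k)"
    and indep: "\<And>k. indep_var borel (\<lambda>\<omega>. real (K \<omega>)) borel (V k)"
    and char_V: "\<And>k. char (distr M borel (V k)) \<theta> = \<psi> k"
  shows "char (distr M borel (\<lambda>\<omega>. V (K \<omega>) \<omega>)) \<theta> = expectation (\<lambda>\<omega>. \<psi> (K \<omega>))"
proof -
  define F where "F \<omega> = iexp (\<theta> * V (K \<omega>) \<omega>)" for \<omega>
  define I :: "nat \<Rightarrow> 'a \<Rightarrow> complex" where "I k \<omega> = of_bool (K \<omega> = k)" for k \<omega>
  have VK[measurable]: "random_variable borel (\<lambda>\<omega>. V (K \<omega>) \<omega>)" by measurable
  have F_meas[measurable]: "random_variable borel F" unfolding F_def[abs_def] by measurable
  have I_meas[measurable]: "random_variable borel (I k)" for k unfolding I_def[abs_def] by measurable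
  have \<psi>_le: "norm (\<psi> k) \<le> 1" for k
    unfolding char_V[symmetric] by (intro real_distribution.cmod_char_le_1 real_distribution_distr V)
  have expect_V: "expectation (\<lambda>\<omega>. iexp (\<theta> * V k \<omega>)) = \<psi> k" for k
    unfolding char_V[symmetric] char_def by (subst integral_distr) auto
  have I_int: "integrable M (I k)" for k
    by (intro integrable_const_bound[where B=1]) (auto simp: I_def)
  have E_int: "integrable M (\<lambda>\<omega>. iexp (\<theta> * V k \<omega>))" for k
    by (intro integrable_const_bound[where B=1]) auto
  have indep_I: "indep_var borel (I k) borel (\<lambda>\<omega>. iexp (\<theta> * V k \<omega>))" for k
  proof -
    have "(\<lambda>x::real. of_bool (x = real k) :: complex) \<in> borel_measurable borel"
      by measurable
    moreover have "(\<lambda>x. iexp (\<theta> * x)) \<in> borel_measurable borel"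
      by measurable
    ultimately have "indep_var borel ((\<lambda>x. of_bool (x = real k) :: complex) \<circ> (\<lambda>\<omega>. real (K \<omega>))) borel ((\<lambda>x. iexp (\<theta> * x)) \<circ> V k)"
      by (intro indep_var_compose[OF indep])
    then show ?thesis by (simp add: comp_def I_def[abs_def])
  qed
  have prod_int: "integrable M (\<lambda>\<omega>. I k \<omega> * iexp (\<theta> * V k \<omega>))" for k
    by (rule indep_var_integrable[OF indep_I I_int E_int])
  have prod_eq: "expectation (\<lambda>\<omega>. I k \<omega> * iexp (\<theta> * V k \<omega>)) = expectation (\<lambda>\<omega>. I k \<omega> * \<psi> k)" for k
    unfolding indep_var_lebesgue_integral[OF indep_I I_int E_int] expect_V by simp
  \<comment> \<open>Truncation to \<open>K < n\<close> leaves finite sums only; dominated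
    convergence removes the truncation at the end.\<close>
  have sum_I: "(\<Sum>k<n. I k \<omega> * f k) = of_bool (K \<omega> < n) * f (K \<omega>)" for n \<omega> and f :: "nat \<Rightarrow> complex"
  proof -
    have "(\<Sum>k<n. I k \<omega> * f k) = (\<Sum>k<n. if k = K \<omega> then f k else 0)"
      by (intro sum.cong) (auto simp: I_def)
    then show ?thesis by simp
  qed
  have eq: "expectation (\<lambda>\<omega>. of_bool (K \<omega> < n) * F \<omega>) = expectation (\<lambda>\<omega>. of_bool (K \<omega> < n) * \<psi> (K \<omega>))" for n
  proof -
    have "expectation (\<lambda>\<omega>. of_bool (K \<omega> < n) * F \<omega>) = expectation (\<lambda>\<omega>. \<Sum>k<n. I k \<omega> * iexp (\<theta> * V k \<omega>))"
      by (simp add: sum_I F_def)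
    also have "\<dots> = (\<Sum>k<n. expectation (\<lambda>\<omega>. I k \<omega> * \<psi> k))"
      by (subst Bochner_Integration.integral_sum) (simp_all only: prod_int prod_eq)
    also have "\<dots> = expectation (\<lambda>\<omega>. \<Sum>k<n. I k \<omega> * \<psi> k)"
      using I_int by (intro Bochner_Integration.integral_sum[symmetric]) auto
    finally show ?thesis by (simp add: sum_I)
  qed
  have lim: "(\<lambda>n. expectation (\<lambda>\<omega>. of_bool (K \<omega> < n) * G \<omega>)) \<longlonglongrightarrow> expectation G"
    if [measurable]: "random_variable borel G" and G: "\<And>\<omega>. norm (G \<omega>) \<le> 1" for G :: "'a \<Rightarrow> complex"
  proof (rule integral_dominated_convergence[where w="\<lambda>_. 1"])
    show "AE \<omega> in M. (\<lambda>n. of_bool (K \<omega> < n) * G \<omega>) \<longlonglongrightarrow> G \<omega>"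
    proof (rule AE_I2, rule tendsto_eventually)
      fix \<omega>
      show "\<forall>\<^sub>F n in sequentially. of_bool (K \<omega> < n) * G \<omega> = G \<omega>"
        using eventually_gt_at_top[of "K \<omega>"] by eventually_elim simp
    qed
    show "AE \<omega> in M. norm (of_bool (K \<omega> < n) * G \<omega>) \<le> 1" for n
      using G by (auto simp: norm_mult)
  qed (use that in measurable)
  have "expectation F = expectation (\<lambda>\<omega>. \<psi> (K \<omega>))"
  proof (rule LIMSEQ_unique)
    show "(\<lambda>n. expectation (\<lambda>\<omega>. of_bool (K \<omega> < n) * F \<omega>)) \<longlonglongrightarrow> expectation F"
      by (rule lim[OF F_meas]) (simp add: F_def)
    show "(\<lambda>n. expectation (\<lambda>\<omega>. of_bool (K \<omega> < n) * F \<omega>)) \<longlonglongrightarrow> expectation (\<lambda>\<omega>. \<psi> (K \<omega>))"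
      unfolding eq by (rule lim) (auto simp: \<psi>_le)
  qed
  then show ?thesis
    unfolding char_def by (subst integral_distr) (auto simp: F_def[abs_def])
qed

section \<open>Laws under the completion and random times\<close>

text \<open>The preimages of \<open>A\<close> under \<open>f\<close> and \<open>g\<close> differ
  only inside the null set where \<open>f\<close> and \<open>g\<close> disagree, and every subset of
  it is measurable in the completion.\<close>

lemma borel_measurable_completion_AE_eq:
  fixes f g :: "'a \<Rightarrow> real"
  assumes g[measurable]: "g \<in> borel_measurable M" and eq: "AE \<omega> in M. f \<omega> = g \<omega>"
  shows "f \<in> borel_measurable (completion M)"
proof (rule measurableI)
  fix A :: "real set"
  assume A[measurable]: "A \<in> sets borel"
  have [measurable]: "g \<in> borel_measurable (completion M)"
    using g by (rule measurable_completion)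
  have [measurable]: "Measurable.pred (completion M) (\<lambda>\<omega>. f \<omega> \<noteq> g \<omega>)"
    "Measurable.pred (completion M) (\<lambda>\<omega>. f \<omega> \<in> A \<and> f \<omega> \<noteq> g \<omega>)"
    using eq by (auto intro!: sets_completion_AE elim!: eventually_mono)
  have "Measurable.pred (completion M) (\<lambda>\<omega>. (g \<omega> \<in> A \<and> \<not> (f \<omega> \<noteq> g \<omega>)) \<or> (f \<omega> \<in> A \<and> f \<omega> \<noteq> g \<omega>))"
    by measurable
  also have "(\<lambda>\<omega>. (g \<omega> \<in> A \<and> \<not> (f \<omega> \<noteq> g \<omega>)) \<or> (f \<omega> \<in> A \<and> f \<omega> \<noteq> g \<omega>)) = (\<lambda>\<omega>. f \<omega> \<in> A)"
    by auto
  finally show "f -` A \<inter> space (completion M) \<in> sets (completion M)"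
    by (simp add: pred_def vimage_def Int_def conj_commute)
qed simp

lemma distr_completion_AE_eq:
  fixes f g :: "'a \<Rightarrow> real"
  assumes g: "g \<in> borel_measurable M" and eq: "AE \<omega> in M. f \<omega> = g \<omega>"
  shows "distr (completion M) borel f = distr M borel g"
proof -
  have "distr (completion M) borel f = distr (completion M) borel g"
    using assms by (intro distr_cong_AE borel_measurable_completion_AE_eq measurable_completion AE_completion) auto
  then show ?thesis using distr_completion[OF g] by simp
qed

text \<open>\<open>T\<close> is approximated by the discrete times \<open>\<lfloor>(m + 1) T\<rfloor> / (m + 1)\<close>, to which
  \<open>char_random_index\<close> applies.\<close>

lemma (in prob_space) random_time_law:
  fixes B :: "real \<Rightarrow> 'a \<Rightarrow> real" and T :: "'a \<Rightarrow> real"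
  assumes B: "\<And>s. 0 \<le> s \<Longrightarrow> random_variable borel (B s)"
    and cont: "AE \<omega> in M. continuous_on {0..} (\<lambda>s. B s \<omega>)"
    and T[measurable]: "random_variable borel T" and T_nonneg: "AE \<omega> in M. 0 \<le> T \<omega>"
    and indep: "\<And>s. 0 \<le> s \<Longrightarrow> indep_var borel T borel (B s)"
    and c: "0 \<le> c"
    and char_B: "\<And>s \<theta>. 0 \<le> s \<Longrightarrow> char (distr M borel (B s)) \<theta> = of_real (exp (- (\<theta>\<^sup>2 * c / 2) * s))"
  shows "real_distribution (distr (completion M) borel (\<lambda>\<omega>. B (T \<omega>) \<omega>))"
    and "char (distr (completion M) borel (\<lambda>\<omega>. B (T \<omega>) \<omega>)) \<theta> =
      of_real (expectation (\<lambda>\<omega>. exp (- (\<theta>\<^sup>2 * c / 2) * T \<omega>)))"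
proof -
  \<comment> \<open>Grid times of mesh \<open>1 / (m + 1)\<close>: \<open>Suc m\<close> avoids a
    division by zero, and \<open>nat\<close> sends negative values of \<open>T\<close>, which have
    probability 0, to 0.\<close>
  define K where "K m \<omega> = nat \<lfloor>real (Suc m) * T \<omega>\<rfloor>" for m \<omega>
  define Y where "Y m \<omega> = B (real (K m \<omega>) / real (Suc m)) \<omega>" for m \<omega>
  \<comment> \<open>As a \<open>lim\<close> of measurable functions, \<open>g\<close> is measurable
    with respect to \<open>M\<close> itself. It agrees with the composed process almost surely, so
    it carries the law taken under the completion.\<close>
  define g where "g \<omega> = lim (\<lambda>m. Y m \<omega>)" for \<omega>
  have K_meas[measurable]: "K m \<in> measurable M (count_space UNIV)" for m
    unfolding K_def[abs_def] by measurable
  have B_meas[measurable]: "random_variable borel (B (real k / real (Suc m)))" for k m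
    by (rule B) simp
  have Y_meas[measurable]: "random_variable borel (Y m)" for m
    unfolding Y_def[abs_def] by (rule measurable_compose_countable[OF B_meas K_meas])
  have g_meas[measurable]: "random_variable borel g"
    unfolding g_def[abs_def] by measurable
  have K_lim: "(\<lambda>m. real (K m \<omega>) / real (Suc m)) \<longlonglongrightarrow> T \<omega>" if "0 \<le> T \<omega>" for \<omega>
  proof (rule LIM_zero_cancel, rule Lim_null_comparison[OF always_eventually lim_inverse_n'[THEN LIMSEQ_Suc]], rule allI)
    fix m
    have "real (Suc m) * T \<omega> - 1 < real (K m \<omega>)" "real (K m \<omega>) \<le> real (Suc m) * T \<omega>"
      using that by (simp_all add: K_def del: of_nat_Suc)
    then have "\<bar>real (K m \<omega>) - real (Suc m) * T \<omega>\<bar> \<le> 1" by linarith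
    moreover have "real (K m \<omega>) / real (Suc m) - T \<omega> = (real (K m \<omega>) - real (Suc m) * T \<omega>) / real (Suc m)"
      by (simp add: field_simps del: of_nat_Suc)
    ultimately show "norm (real (K m \<omega>) / real (Suc m) - T \<omega>) \<le> 1 / real (Suc m)"
      by (simp add: divide_right_mono del: of_nat_Suc)
  qed
  have Y_lim: "AE \<omega> in M. (\<lambda>m. Y m \<omega>) \<longlonglongrightarrow> B (T \<omega>) \<omega>"
    using cont T_nonneg
  proof eventually_elim
    case (elim \<omega>)
    show ?case
      unfolding Y_def
      by (rule continuous_on_tendsto_compose[OF elim(1) K_lim]) (use elim in \<open>auto simp del: of_nat_Suc\<close>)
  qed
  have g_eq: "AE \<omega> in M. B (T \<omega>) \<omega> = g \<omega>"
    using Y_lim by eventually_elim (simp add: g_def limI)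
  have Y_lim_g: "AE \<omega> in M. (\<lambda>m. Y m \<omega>) \<longlonglongrightarrow> g \<omega>"
    using Y_lim g_eq by eventually_elim simp
  have distr_eq: "distr (completion M) borel (\<lambda>\<omega>. B (T \<omega>) \<omega>) = distr M borel g"
    by (rule distr_completion_AE_eq[OF g_meas g_eq])
  show "real_distribution (distr (completion M) borel (\<lambda>\<omega>. B (T \<omega>) \<omega>))"
    unfolding distr_eq by (rule real_distribution_distr[OF g_meas])
  \<comment> \<open>\<open>K m\<close> is a Borel function of \<open>T\<close> and inherits its
    independence from each \<open>B s\<close>.\<close>
  have char_Y: "char (distr M borel (Y m)) \<theta> = of_real (expectation (\<lambda>\<omega>. exp (- (\<theta>\<^sup>2 * c / 2) * (real (K m \<omega>) / real (Suc m)))))" for m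
  proof -
    have "char (distr M borel (\<lambda>\<omega>. B (real (K m \<omega>) / real (Suc m)) \<omega>)) \<theta> =
        expectation (\<lambda>\<omega>. complex_of_real (exp (- (\<theta>\<^sup>2 * c / 2) * (real (K m \<omega>) / real (Suc m)))))"
    proof (rule char_random_index[OF K_meas B_meas])
      fix k
      have "(\<lambda>x. real (nat \<lfloor>real (Suc m) * x\<rfloor>)) \<in> borel_measurable borel" by measurable
      then have "indep_var borel ((\<lambda>x. real (nat \<lfloor>real (Suc m) * x\<rfloor>)) \<circ> T) borel ((\<lambda>x. x) \<circ> B (real k / real (Suc m)))"
        by (intro indep_var_compose[OF indep]) auto
      then show "indep_var borel (\<lambda>\<omega>. real (K m \<omega>)) borel (B (real k / real (Suc m)))"
        by (simp add: comp_def K_def del: of_nat_Suc)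
      show "char (distr M borel (B (real k / real (Suc m)))) \<theta> =
          complex_of_real (exp (- (\<theta>\<^sup>2 * c / 2) * (real k / real (Suc m))))"
        by (rule char_B) simp
    qed
    also have "\<dots> = of_real (expectation (\<lambda>\<omega>. exp (- (\<theta>\<^sup>2 * c / 2) * (real (K m \<omega>) / real (Suc m)))))"
      by (rule integral_complex_of_real)
    finally show ?thesis by (simp only: Y_def[abs_def])
  qed
  have lim1: "(\<lambda>m. char (distr M borel (Y m)) \<theta>) \<longlonglongrightarrow> char (distr M borel g) \<theta>"
  proof -
    have "(\<lambda>m. expectation (\<lambda>\<omega>. iexp (\<theta> * Y m \<omega>))) \<longlonglongrightarrow> expectation (\<lambda>\<omega>. iexp (\<theta> * g \<omega>))"
    proof (rule integral_dominated_convergence[where w="\<lambda>_. 1"])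
      show "AE \<omega> in M. (\<lambda>m. iexp (\<theta> * Y m \<omega>)) \<longlonglongrightarrow> iexp (\<theta> * g \<omega>)"
        using Y_lim_g by eventually_elim (intro tendsto_intros)
    qed auto
    then show ?thesis by (simp add: char_def integral_distr)
  qed
  have lim2: "(\<lambda>m. expectation (\<lambda>\<omega>. exp (- (\<theta>\<^sup>2 * c / 2) * (real (K m \<omega>) / real (Suc m)))))
      \<longlonglongrightarrow> expectation (\<lambda>\<omega>. exp (- (\<theta>\<^sup>2 * c / 2) * T \<omega>))"
  proof (rule integral_dominated_convergence[where w="\<lambda>_. 1"])
    show "AE \<omega> in M. (\<lambda>m. exp (- (\<theta>\<^sup>2 * c / 2) * (real (K m \<omega>) / real (Suc m)))) \<longlonglongrightarrow> exp (- (\<theta>\<^sup>2 * c / 2) * T \<omega>)"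
      using T_nonneg by eventually_elim (intro tendsto_exp tendsto_mult tendsto_const K_lim)
  \<comment> \<open>With \<open>c\<close> and \<open>K\<close> nonnegative the exponent is at most
    0, so the constant 1 dominates.\<close>
  qed (use c in \<open>auto simp: mult_nonneg_nonneg\<close>)
  show "char (distr (completion M) borel (\<lambda>\<omega>. B (T \<omega>) \<omega>)) \<theta> =
      of_real (expectation (\<lambda>\<omega>. exp (- (\<theta>\<^sup>2 * c / 2) * T \<omega>)))"
    unfolding distr_eq
  proof (rule LIMSEQ_unique[OF lim1])
    show "(\<lambda>m. char (distr M borel (Y m)) \<theta>) \<longlonglongrightarrow> of_real (expectation (\<lambda>\<omega>. exp (- (\<theta>\<^sup>2 * c / 2) * T \<omega>)))"
      unfolding char_Y by (intro tendsto_of_real lim2)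
  qed
qed

section \<open>Independence of processes\<close>

text \<open>The family \<open>process_events\<close> in the form of a measure space, so that being
  determined by the process becomes membership in \<open>measurable\<close>.\<close>

definition process_sigma :: "'a measure \<Rightarrow> 'i set \<Rightarrow> 'b measure \<Rightarrow> ('i \<Rightarrow> 'a \<Rightarrow> 'b) \<Rightarrow> 'a measure" where
  "process_sigma M I S X = sigma (space M) {X i -` A \<inter> space M | i A. i \<in> I \<and> A \<in> sets S}"

lemma space_process_sigma[simp]: "space (process_sigma M I S X) = space M"
  by (auto simp: process_sigma_def space_measure_of_conv)

lemma sets_process_sigma: "sets (process_sigma M I S X) = process_events M I S X"
  unfolding process_sigma_def process_events_def by (rule sets_measure_of) auto

lemma measurable_process_sigma:
  assumes "i \<in> I" "space S = UNIV"
  shows "X i \<in> measurable (process_sigma M I S X) S"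
proof (rule measurableI)
  fix A assume "A \<in> sets S"
  then show "X i -` A \<inter> space (process_sigma M I S X) \<in> sets (process_sigma M I S X)"
    using assms by (auto simp: sets_process_sigma process_events_def)
qed (use assms in auto)

lemma measurable_and_sigma_sets_subset:
  assumes "X \<in> measurable P N" "space P = space M" "sets P \<subseteq> sets M"
  shows "X \<in> measurable M N \<and> sigma_sets (space M) {X -` A \<inter> space M | A. A \<in> sets N} \<subseteq> sets P"
proof
  show "X \<in> measurable M N"
    using assms by (auto simp: measurable_def)
  show "sigma_sets (space M) {X -` A \<inter> space M | A. A \<in> sets N} \<subseteq> sets P"
    unfolding assms(2)[symmetric] using assms(1)
    by (intro sets.sigma_sets_subset) (auto simp: measurable_def)
qed

text \<open>A variable measurable for the sigma-algebra of a process generates a smaller one, and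
  independence passes to sub-families. This yields independence of functionals from independence of
  whole processes.\<close>

lemma (in prob_space) indep_var_of_process_events:
  assumes indep: "indep_set (process_events M I S X) (process_events M J T Y)"
    and U: "U \<in> measurable (process_sigma M I S X) S'"
    and V: "V \<in> measurable (process_sigma M J T Y) T'"
  shows "indep_var S' U T' V"
proof -
  have sub: "process_events M I S X \<subseteq> events" "process_events M J T Y \<subseteq> events"
    using indep by (auto simp: indep_sets2_eq)
  have UV: "U \<in> measurable M S' \<and> sigma_sets (space M) {U -` A \<inter> space M | A. A \<in> sets S'} \<subseteq> process_events M I S X"
    "V \<in> measurable M T' \<and> sigma_sets (space M) {V -` A \<inter> space M | A. A \<in> sets T'} \<subseteq> process_events M J T Y"
    using measurable_and_sigma_sets_subset[OF U] measurable_and_sigma_sets_subset[OF V] sub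
    by (simp_all add: sets_process_sigma)
  show ?thesis
    unfolding indep_var_eq
  proof (intro conjI)
    show "indep_set (sigma_sets (space M) {U -` A \<inter> space M | A. A \<in> sets S'})
        (sigma_sets (space M) {V -` A \<inter> space M | A. A \<in> sets T'})"
      using indep unfolding indep_set_def
      by (rule indep_sets_mono_sets) (use UV in \<open>auto split: bool.split\<close>)
  qed (use UV in auto)
qed

section \<open>Convergence of the random sums\<close>

lemma (in prob_space) char_normal:
  assumes "distributed M lborel X (\<lambda>x. ennreal (normal_density 0 \<sigma> x))" and "0 < \<sigma>"
  shows "char (distr M borel X) \<theta> = of_real (exp (- (\<theta>\<^sup>2 * \<sigma>\<^sup>2 / 2)))"
proof -
  have X[measurable]: "random_variable borel X"
    using assms(1) by (auto simp: distributed_def)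
  have std: "distributed M lborel (\<lambda>x. (X x - 0) / \<sigma>) std_normal_density"
    using assms normal_standard_normal_convert[of \<sigma> X 0] by simp
  have "char (distr M borel X) \<theta> = char (distr M borel (\<lambda>\<omega>. (X \<omega> - 0) / \<sigma>)) (\<theta> * \<sigma>)"
    using assms(2) by (simp add: char_def integral_distr)
  also have "distr M borel (\<lambda>\<omega>. (X \<omega> - 0) / \<sigma>) = std_normal_distribution"
    using std by (auto simp: distributed_def cong: distr_cong)
  finally show ?thesis
    by (simp add: char_std_normal_distribution power_mult_distrib)
qed

text \<open>Since the sheet vanishes on the axes, \<open>W s t\<close> is almost surely its
  increment over the rectangle from the origin, with variance \<open>s * t\<close>. If
  \<open>s\<close> or \<open>t\<close> is 0 there is no density; the law is then the point mass at
  0.\<close>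

lemma (in prob_space) char_brownian_sheet:
  assumes W: "brownian_sheet M W" and s: "0 \<le> s" "0 \<le> t"
  shows "char (distr M borel (W s t)) \<theta> = of_real (exp (- (\<theta>\<^sup>2 * (s * t) / 2)))"
proof -
  have meas: "random_variable borel (W a b)" if "0 \<le> a" "0 \<le> b" for a b
    using W that by (simp add: brownian_sheet_def)
  have axes: "AE \<omega> in M. W 0 a \<omega> = 0" "AE \<omega> in M. W a 0 \<omega> = 0" if "0 \<le> a" for a
    using W that by (auto simp: brownian_sheet_def)
  show ?thesis
  proof (cases "s = 0 \<or> t = 0")
    case True
    then have "AE \<omega> in M. W s t \<omega> = 0"
      using axes s by auto
    then have "distr M borel (W s t) = distr M borel (\<lambda>_. 0)"
      using meas s by (intro distr_cong_AE) auto
    then show ?thesis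
      using True by (auto simp: char_def integral_distr prob_space simp del: distr_const)
  next
    case False
    with s have pos: "0 < s" "0 < t" by auto
    have inc: "distributed M lborel (rect_increment W 0 s 0 t) (\<lambda>x. ennreal (normal_density 0 (sqrt ((s - 0) * (t - 0))) x))"
      using W pos unfolding brownian_sheet_def by blast
    have "distr M borel (W s t) = distr M borel (rect_increment W 0 s 0 t)"
    proof (rule distr_cong_AE)
      show "AE \<omega> in M. W s t \<omega> = rect_increment W 0 s 0 t \<omega>"
        using axes(1)[OF s(2)] axes(2)[OF s(1)] axes(1)[of 0]
        by (auto simp: rect_increment_def)
      show "rect_increment W 0 s 0 t \<in> borel_measurable M"
        using inc by (auto simp: distributed_def)
    qed (auto intro: meas s)
    then show ?thesis
      using char_normal[OF inc] pos by simp
  qed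
qed

lemma continuous_on_section:
  assumes "continuous_on ({0..} \<times> {0..}) (\<lambda>(s, t). f s t)" and "0 \<le> (t::real)"
  shows "continuous_on {0..} (\<lambda>s::real. f s t)" and "continuous_on {0..} (\<lambda>s. f t s)"
proof -
  have "continuous_on {0..} ((\<lambda>(s, t). f s t) \<circ> (\<lambda>s. (s, t)))"
    using assms by (intro continuous_on_compose continuous_intros) (auto intro: continuous_on_subset)
  then show "continuous_on {0..} (\<lambda>s. f s t)" by (simp add: comp_def)
  have "continuous_on {0..} ((\<lambda>(s, t). f s t) \<circ> (\<lambda>s. (t, s)))"
    using assms by (intro continuous_on_compose continuous_intros) (auto intro: continuous_on_subset)
  then show "continuous_on {0..} (\<lambda>s. f t s)" by (simp add: comp_def)
qed

section \<open>Weak limit of normalized random sums\<close>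

text \<open>This is the derivative of \<open>exp (- a * x)\<close> at 0, taken along
  \<open>x = 1 / (n + 1)\<close> to avoid \<open>n = 0\<close> and then shifted back.\<close>

lemma tendsto_times_exp_inverse_minus_1:
  fixes a :: real
  shows "(\<lambda>n. real n * (exp (- (a / real n)) - 1)) \<longlonglongrightarrow> - a"
proof -
  have "((\<lambda>x. exp (- (a * x))) has_real_derivative - a) (at 0)"
    by (auto intro!: derivative_eq_intros)
  then have "((\<lambda>h. (exp (- (a * h)) - 1) / h) \<longlongrightarrow> - a) (at 0)"
    by (simp add: DERIV_def)
  then have "(\<lambda>n. (exp (- (a * (1 / real (Suc n)))) - 1) / (1 / real (Suc n))) \<longlonglongrightarrow> - a"
    by (rule filterlim_compose) (auto simp: filterlim_at lim_inverse_n'[THEN LIMSEQ_Suc] simp del: of_nat_Suc)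
  then have "(\<lambda>n. real (Suc n) * (exp (- (a / real (Suc n))) - 1)) \<longlonglongrightarrow> - a"
    by (simp add: mult.commute del: of_nat_Suc)
  then show ?thesis by (rule LIMSEQ_imp_Suc)
qed

text \<open>Common form of both claims: the field enters through the Laplace transforms of the
  \<open>K n\<close>, the limit through its characteristic function. The arguments of the
  Mittag-Leffler function converge, and its continuity gives convergence of the characteristic
  functions.\<close>

lemma random_sum_converges_in_distribution:
  fixes M :: "'a measure" and M' :: "'b measure"
    and K :: "nat \<Rightarrow> 'a \<Rightarrow> nat" and Z :: "nat \<Rightarrow> 'a \<Rightarrow> real" and Y :: "'b \<Rightarrow> real"
  assumes M: "prob_space M" and \<alpha>: "0 < \<alpha>"
    and Z_indep: "prob_space.indep_vars M (\<lambda>_. borel) Z {1..}"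
    and Z_normal: "\<And>j. 1 \<le> j \<Longrightarrow> distributed M lborel (Z j) (\<lambda>x. ennreal (std_normal_density x))"
    and K[measurable]: "\<And>n. K n \<in> measurable M (count_space UNIV)"
    and indep: "\<And>n k a. prob_space.indep_var M borel (\<lambda>\<omega>. real (K n \<omega>)) borel (\<lambda>\<omega>. a * (\<Sum>j = 1..k. Z j \<omega>))"
    and laplace: "\<And>n u. 0 < u \<Longrightarrow>
      integral\<^sup>L M (\<lambda>\<omega>. exp (- u * real (K n \<omega>))) = mittag_leffler \<alpha> (c * (real n * (exp (- u) - 1)))"
    and Y: "real_distribution (distr (completion M') borel Y)"
    and char_Y: "\<And>\<theta>. char (distr (completion M') borel Y) \<theta> = of_real (mittag_leffler \<alpha> (- (c * (\<theta>\<^sup>2 / 2))))"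
  shows "converges_in_distribution M (\<lambda>n \<omega>. real n powr (- 1 / 2) * (\<Sum>j = 1..K n \<omega>. Z j \<omega>)) M' Y"
proof -
  interpret prob_space M by (rule M)
  have Z_meas: "random_variable borel (Z j)" if "1 \<le> j" for j
    using Z_normal[OF that] by (auto simp: distributed_def)
  have S_meas[measurable]: "random_variable borel (\<lambda>\<omega>. a * (\<Sum>j = 1..k. Z j \<omega>))" for a k
    using Z_meas by (intro borel_measurable_times borel_measurable_const borel_measurable_sum) auto
  \<comment> \<open>At \<open>n = 0\<close> the factor \<open>0 powr (- 1 / 2)\<close> is 0; a
    single term does not influence the limit.\<close>
  define X where "X n \<omega> = real n powr (- 1 / 2) * (\<Sum>j = 1..K n \<omega>. Z j \<omega>)" for n \<omega>
  have X_meas: "random_variable borel (X n)" for n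
    unfolding X_def[abs_def] by (rule measurable_compose_countable[OF S_meas K])
  have char_Z: "char (distr M borel (Z j)) \<theta> = of_real (exp (- (\<theta>\<^sup>2 / 2)))" if "1 \<le> j" for j \<theta>
    using char_normal[OF Z_normal[OF that], of \<theta>] by simp
  \<comment> \<open>The scale \<open>a\<close> moves into the argument, and independence gives a
    product of \<open>k\<close> equal Gaussian factors.\<close>
  have char_S: "char (distr M borel (\<lambda>\<omega>. a * (\<Sum>j = 1..k. Z j \<omega>))) \<theta> = of_real (exp (- (a\<^sup>2 * \<theta>\<^sup>2 / 2) * real k))" for a k \<theta>
  proof -
    have "char (distr M borel (\<lambda>\<omega>. a * (\<Sum>j = 1..k. Z j \<omega>))) \<theta> = char (distr M borel (\<lambda>\<omega>. \<Sum>j = 1..k. Z j \<omega>)) (a * \<theta>)"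
      using S_meas[of a k] S_meas[of 1 k] by (simp add: char_def integral_distr mult_ac)
    also have "\<dots> = (\<Prod>j = 1..k. char (distr M borel (Z j)) (a * \<theta>))"
      by (intro char_distr_sum indep_vars_subset[OF Z_indep]) auto
    also have "\<dots> = (\<Prod>j = 1..k. of_real (exp (- ((a * \<theta>)\<^sup>2 / 2))))"
      by (intro prod.cong char_Z) auto
    also have "\<dots> = of_real (exp (real k * (- ((a * \<theta>)\<^sup>2 / 2))))"
      by (simp only: prod_constant card_atLeastAtMost exp_of_nat_mult) simp
    finally show ?thesis by (simp add: power_mult_distrib mult.commute)
  qed
  \<comment> \<open>The Laplace transform is used at \<open>u = \<theta>\<^sup>2 / (2 * n)\<close>,
    which must be positive; hence both conditions. At \<open>\<theta> = 0\<close> every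
    characteristic function is 1.\<close>
  have char_X: "char (distr M borel (X n)) \<theta> = of_real (mittag_leffler \<alpha> (c * (real n * (exp (- ((\<theta>\<^sup>2 / 2) / real n)) - 1))))"
    if "0 < n" "\<theta> \<noteq> 0" for n \<theta>
  proof -
    have sq: "(real n powr (- 1 / 2))\<^sup>2 = 1 / real n"
    proof -
      have "(real n powr (- 1 / 2))\<^sup>2 = real n powr (- 1)"
        by (simp only: power2_eq_square powr_add[symmetric]) simp
      then show ?thesis by (simp add: powr_minus_divide)
    qed
    have "char (distr M borel (X n)) \<theta> = expectation (\<lambda>\<omega>. complex_of_real (exp (- ((real n powr (- 1 / 2))\<^sup>2 * \<theta>\<^sup>2 / 2) * real (K n \<omega>))))"
      unfolding X_def[abs_def] by (rule char_random_index[OF K S_meas indep char_S])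
    also have "\<dots> = of_real (expectation (\<lambda>\<omega>. exp (- ((\<theta>\<^sup>2 / 2) / real n) * real (K n \<omega>))))"
      unfolding sq by (subst integral_complex_of_real[symmetric]) (simp add: mult.commute)
    also have "\<dots> = of_real (mittag_leffler \<alpha> (c * (real n * (exp (- ((\<theta>\<^sup>2 / 2) / real n)) - 1))))"
      using that by (subst laplace) auto
    finally show ?thesis .
  qed
  have "weak_conv_m (\<lambda>n. distr M borel (X n)) (distr (completion M') borel Y)"
  proof (rule levy_continuity[OF _ Y])
    show "real_distribution (distr M borel (X n))" for n
      by (rule real_distribution_distr[OF X_meas])
    fix \<theta> :: real
    show "(\<lambda>n. char (distr M borel (X n)) \<theta>) \<longlonglongrightarrow> char (distr (completion M') borel Y) \<theta>"
    proof (cases "\<theta> = 0")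
      case True
      then show ?thesis
        by (simp add: real_distribution.char_zero Y real_distribution_distr X_meas)
    next
      case False
      have "(\<lambda>n. c * (real n * (exp (- ((\<theta>\<^sup>2 / 2) / real n)) - 1))) \<longlonglongrightarrow> c * - (\<theta>\<^sup>2 / 2)"
        by (intro tendsto_mult tendsto_const tendsto_times_exp_inverse_minus_1)
      then have "(\<lambda>n. complex_of_real (mittag_leffler \<alpha> (c * (real n * (exp (- ((\<theta>\<^sup>2 / 2) / real n)) - 1)))))
          \<longlonglongrightarrow> of_real (mittag_leffler \<alpha> (c * - (\<theta>\<^sup>2 / 2)))"
        by (intro tendsto_of_real isCont_tendsto_compose[OF isCont_mittag_leffler[OF \<alpha>]])
      then have "(\<lambda>n. char (distr M borel (X n)) \<theta>) \<longlonglongrightarrow> of_real (mittag_leffler \<alpha> (c * - (\<theta>\<^sup>2 / 2)))"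
      proof (rule Lim_transform_eventually)
        show "\<forall>\<^sub>F n in sequentially. complex_of_real (mittag_leffler \<alpha> (c * (real n * (exp (- ((\<theta>\<^sup>2 / 2) / real n)) - 1))))
            = char (distr M borel (X n)) \<theta>"
          using eventually_gt_at_top[of 0] by eventually_elim (rule char_X[OF _ False, symmetric])
      qed
      then show ?thesis by (simp add: char_Y)
    qed
  qed
  then show ?thesis
    by (simp add: converges_in_distribution_def X_def[abs_def])
qed

section \<open>Application to the two fractional Poisson fields\<close>

text \<open>The index 1 contributes \<open>Gamma (k + 1) = k!\<close>, which cancels the factorial
  in the series and leaves a Mittag-Leffler series of order \<open>\<alpha>\<close>.\<close>

lemma fractional_poisson_laplace_mittag_leffler:
  assumes "0 \<le> t1" "0 \<le> t2" "0 < u"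
  shows "fractional_poisson_laplace M 1 \<alpha> 1 N \<Longrightarrow>
      integral\<^sup>L M (\<lambda>\<omega>. exp (- u * real (N t1 t2 \<omega>))) = mittag_leffler \<alpha> (t1 powr \<alpha> * t2 * (exp (- u) - 1))"
    and "fractional_poisson_laplace M 1 1 \<alpha> N \<Longrightarrow>
      integral\<^sup>L M (\<lambda>\<omega>. exp (- u * real (N t1 t2 \<omega>))) = mittag_leffler \<alpha> (t2 powr \<alpha> * t1 * (exp (- u) - 1))"
proof -
  have fact: "Gamma (real k + 1) = fact k" for k
    using Gamma_fact[of k, where 'a=real] by (simp add: add.commute)
  show "integral\<^sup>L M (\<lambda>\<omega>. exp (- u * real (N t1 t2 \<omega>))) = mittag_leffler \<alpha> (t1 powr \<alpha> * t2 * (exp (- u) - 1))"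
    if "fractional_poisson_laplace M 1 \<alpha> 1 N"
    using that assms by (simp add: fractional_poisson_laplace_def mittag_leffler_def fact)
  show "integral\<^sup>L M (\<lambda>\<omega>. exp (- u * real (N t1 t2 \<omega>))) = mittag_leffler \<alpha> (t2 powr \<alpha> * t1 * (exp (- u) - 1))"
    if "fractional_poisson_laplace M 1 1 \<alpha> N"
    using that assms by (simp add: fractional_poisson_laplace_def mittag_leffler_def fact mult.commute[of t1])
qed

lemma (in prob_space) indep_var_index_sum:
  fixes N :: "'i \<Rightarrow> 'a \<Rightarrow> nat" and Z :: "nat \<Rightarrow> 'a \<Rightarrow> real"
  assumes indep: "indep_set (process_events M I (count_space UNIV) N) (process_events M {1..} borel Z)"
    and i: "i \<in> I"
  shows "indep_var borel (\<lambda>\<omega>. real (N i \<omega>)) borel (\<lambda>\<omega>. a * (\<Sum>j = 1..k. Z j \<omega>))"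
proof (rule indep_var_of_process_events[OF indep])
  have [measurable]: "N i \<in> measurable (process_sigma M I (count_space UNIV) N) (count_space UNIV)"
    using i by (rule measurable_process_sigma) simp
  show "(\<lambda>\<omega>. real (N i \<omega>)) \<in> borel_measurable (process_sigma M I (count_space UNIV) N)"
    by measurable
  have "Z j \<in> borel_measurable (process_sigma M {1..} borel Z)" if "j \<in> {1..k}" for j
    using that by (intro measurable_process_sigma) auto
  then show "(\<lambda>\<omega>. a * (\<Sum>j = 1..k. Z j \<omega>)) \<in> borel_measurable (process_sigma M {1..} borel Z)"
    by (intro borel_measurable_times borel_measurable_const borel_measurable_sum)
qed

theorem mainTheorem10:
  fixes M :: "'a measure" and M' :: "'b measure"
    and N1 N2 :: "real \<Rightarrow> real \<Rightarrow> 'a \<Rightarrow> nat"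
    and Z :: "nat \<Rightarrow> 'a \<Rightarrow> real"
    and W :: "real \<Rightarrow> real \<Rightarrow> 'b \<Rightarrow> real"
    and L :: "real \<Rightarrow> 'b \<Rightarrow> real"
    and \<alpha> t1 t2 :: real
  assumes \<alpha>: "0 < \<alpha>" "\<alpha> < 1"
    and M: "prob_space M"
    and N1: "fractional_poisson_field M 1 \<alpha> 1 N1"
    and N2: "fractional_poisson_field M 1 1 \<alpha> N2"
    and N1_laplace: "fractional_poisson_laplace M 1 \<alpha> 1 N1"
    and N2_laplace: "fractional_poisson_laplace M 1 1 \<alpha> N2"
    and Z_indep: "prob_space.indep_vars M (\<lambda>_. borel) Z {1..}"
    and Z_normal: "\<And>j. 1 \<le> j \<Longrightarrow> distributed M lborel (Z j) (\<lambda>x. ennreal (std_normal_density x))"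
    and Z_N1_indep: "prob_space.indep_set M
      (process_events M ({0..} \<times> {0..}) (count_space UNIV) (\<lambda>(s, t). N1 s t))
      (process_events M {1..} borel Z)"
    and Z_N2_indep: "prob_space.indep_set M
      (process_events M ({0..} \<times> {0..}) (count_space UNIV) (\<lambda>(s, t). N2 s t))
      (process_events M {1..} borel Z)"
    and M': "prob_space M'"
    and W: "brownian_sheet M' W"
    and L: "inverse_stable_subordinator M' \<alpha> L"
    and W_L_indep: "prob_space.indep_set M'
      (process_events M' ({0..} \<times> {0..}) borel (\<lambda>(s, t). W s t))
      (process_events M' {0..} borel L)"
    and t: "0 \<le> t1" "0 \<le> t2"
  shows "converges_in_distribution
           M (\<lambda>n \<omega>. real n powr (- 1 / 2) * (\<Sum>j = 1..N1 t1 (real n * t2) \<omega>. Z j \<omega>))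
           M' (\<lambda>\<omega>. W (L t1 \<omega>) t2 \<omega>) \<and>
         converges_in_distribution
           M (\<lambda>n \<omega>. real n powr (- 1 / 2) * (\<Sum>j = 1..N2 (real n * t1) t2 \<omega>. Z j \<omega>))
           M' (\<lambda>\<omega>. W t1 (L t2 \<omega>) \<omega>)"
proof -
  interpret M: prob_space M by (rule M)
  interpret M': prob_space M' by (rule M')
  have N1_meas: "N1 a b \<in> measurable M (count_space UNIV)"
    and N2_meas: "N2 a b \<in> measurable M (count_space UNIV)" if "0 \<le> a" "0 \<le> b" for a b
    using N1 N2 that by (simp_all add: fractional_poisson_field_def)
  have W_meas: "W a b \<in> borel_measurable M'" if "0 \<le> a" "0 \<le> b" for a b
    using W that by (simp add: brownian_sheet_def)
  have "AE \<omega> in M'. continuous_on ({0..} \<times> {0..}) (\<lambda>(t1, t2). W t1 t2 \<omega>)"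
    using W by (simp add: brownian_sheet_def)
  then have W_cont: "AE \<omega> in M'. continuous_on {0..} (\<lambda>s. W s b \<omega>)"
      "AE \<omega> in M'. continuous_on {0..} (\<lambda>s. W b s \<omega>)" if "0 \<le> b" for b
    by (auto elim!: eventually_mono intro: continuous_on_section[OF _ that])
  have L_meas: "L s \<in> borel_measurable M'" if "0 \<le> s" for s
    using L that by (simp add: inverse_stable_subordinator_def)
  note L_nonneg = M'.inverse_stable_subordinator_nonneg_and_laplace(1)[OF \<alpha>(1) L]
    and L_laplace = M'.inverse_stable_subordinator_nonneg_and_laplace(2)[OF \<alpha>(1) L]
  have indep_LW: "M'.indep_var borel (L s) borel (W a b)" if "0 \<le> s" "0 \<le> a" "0 \<le> b" for s a b
  proof -
    have "W a b \<in> borel_measurable (process_sigma M' ({0..} \<times> {0..}) borel (\<lambda>(s, t). W s t))"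
      using measurable_process_sigma[of "(a, b)" "{0..} \<times> {0..}" borel "\<lambda>(s, t). W s t" M'] that by simp
    moreover have "L s \<in> borel_measurable (process_sigma M' {0..} borel L)"
      using that by (intro measurable_process_sigma) auto
    \<comment> \<open>The order is exchanged because the random time comes first in
      \<open>random_time_law\<close>.\<close>
    moreover have "M'.indep_set (process_events M' {0..} borel L)
        (process_events M' ({0..} \<times> {0..}) borel (\<lambda>(s, t). W s t))"
      using W_L_indep unfolding M'.indep_sets2_eq by (metis Int_commute mult.commute)
    ultimately show ?thesis
      by (intro M'.indep_var_of_process_events)
  qed

  have "converges_in_distribution
           M (\<lambda>n \<omega>. real n powr (- 1 / 2) * (\<Sum>j = 1..N1 t1 (real n * t2) \<omega>. Z j \<omega>))
           M' (\<lambda>\<omega>. W (L t1 \<omega>) t2 \<omega>)"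
  \<comment> \<open>The transform of \<open>N1 t1 (n * t2)\<close> has argument
    \<open>t1 powr \<alpha> * (n * t2) * (exp (- u) - 1)\<close>. The factor \<open>n\<close> comes
    out linearly, as it scales the coordinate of index 1.\<close>
  proof (rule random_sum_converges_in_distribution[OF M \<alpha>(1) Z_indep Z_normal, where c="t1 powr \<alpha> * t2"])
    show "M.indep_var borel (\<lambda>\<omega>. real (N1 t1 (real n * t2) \<omega>)) borel (\<lambda>\<omega>. a * (\<Sum>j = 1..k. Z j \<omega>))" for n k a
      using M.indep_var_index_sum[OF Z_N1_indep, of "(t1, real n * t2)"] t by simp
    show "M.expectation (\<lambda>\<omega>. exp (- u * real (N1 t1 (real n * t2) \<omega>)))
        = mittag_leffler \<alpha> (t1 powr \<alpha> * t2 * (real n * (exp (- u) - 1)))" if "0 < u" for n u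
      using fractional_poisson_laplace_mittag_leffler(1)[OF t(1) _ that N1_laplace, of "real n * t2"] t
      by (simp add: mult_ac)
    have law: "real_distribution (distr (completion M') borel (\<lambda>\<omega>. W (L t1 \<omega>) t2 \<omega>))"
      "char (distr (completion M') borel (\<lambda>\<omega>. W (L t1 \<omega>) t2 \<omega>)) \<theta>
        = of_real (M'.expectation (\<lambda>\<omega>. exp (- (\<theta>\<^sup>2 * t2 / 2) * L t1 \<omega>)))" for \<theta>
    proof -
      \<comment> \<open>For fixed \<open>t2\<close> the section \<open>s \<mapsto> W s t2\<close>
        has variance \<open>t2 * s\<close>, so \<open>t2\<close> is the variance rate and
        \<open>L t1\<close> the random time.\<close>
      have char: "char (distr M' borel (W s t2)) \<theta> = of_real (exp (- (\<theta>\<^sup>2 * t2 / 2) * s))" if "0 \<le> s" for s \<theta>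
        using M'.char_brownian_sheet[OF W, of s t2 \<theta>] that t by (simp add: mult_ac)
      note law = M'.random_time_law[of "\<lambda>s. W s t2", OF W_meas[OF _ t(2)] W_cont(1)[OF t(2)]
          L_meas[OF t(1)] L_nonneg[OF t(1)] indep_LW[OF t(1) _ t(2)] t(2) char]
      show "real_distribution (distr (completion M') borel (\<lambda>\<omega>. W (L t1 \<omega>) t2 \<omega>))"
        by (rule law(1))
      show "char (distr (completion M') borel (\<lambda>\<omega>. W (L t1 \<omega>) t2 \<omega>)) \<theta>
          = of_real (M'.expectation (\<lambda>\<omega>. exp (- (\<theta>\<^sup>2 * t2 / 2) * L t1 \<omega>)))"
        by (rule law(2))
    qed
    show "real_distribution (distr (completion M') borel (\<lambda>\<omega>. W (L t1 \<omega>) t2 \<omega>))"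
      by (rule law)
    show "char (distr (completion M') borel (\<lambda>\<omega>. W (L t1 \<omega>) t2 \<omega>)) \<theta>
        = of_real (mittag_leffler \<alpha> (- (t1 powr \<alpha> * t2 * (\<theta>\<^sup>2 / 2))))" for \<theta>
      unfolding law L_laplace[OF t(1)] by (simp add: mult_ac)
  qed (use t in \<open>auto intro: N1_meas\<close>)
  moreover have "converges_in_distribution
           M (\<lambda>n \<omega>. real n powr (- 1 / 2) * (\<Sum>j = 1..N2 (real n * t1) t2 \<omega>. Z j \<omega>))
           M' (\<lambda>\<omega>. W t1 (L t2 \<omega>) \<omega>)"
  \<comment> \<open>The coordinates exchange roles: the first has index 1 and is scaled by
    \<open>n\<close>, and the section runs in the second with variance rate
    \<open>t1\<close>.\<close>
  proof (rule random_sum_converges_in_distribution[OF M \<alpha>(1) Z_indep Z_normal, where c="t2 powr \<alpha> * t1"])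
    show "M.indep_var borel (\<lambda>\<omega>. real (N2 (real n * t1) t2 \<omega>)) borel (\<lambda>\<omega>. a * (\<Sum>j = 1..k. Z j \<omega>))" for n k a
      using M.indep_var_index_sum[OF Z_N2_indep, of "(real n * t1, t2)"] t by simp
    show "M.expectation (\<lambda>\<omega>. exp (- u * real (N2 (real n * t1) t2 \<omega>)))
        = mittag_leffler \<alpha> (t2 powr \<alpha> * t1 * (real n * (exp (- u) - 1)))" if "0 < u" for n u
      using fractional_poisson_laplace_mittag_leffler(2)[OF _ t(2) that N2_laplace, of "real n * t1"] t
      by (simp add: mult_ac)
    have law: "real_distribution (distr (completion M') borel (\<lambda>\<omega>. W t1 (L t2 \<omega>) \<omega>))"
      "char (distr (completion M') borel (\<lambda>\<omega>. W t1 (L t2 \<omega>) \<omega>)) \<theta>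
        = of_real (M'.expectation (\<lambda>\<omega>. exp (- (\<theta>\<^sup>2 * t1 / 2) * L t2 \<omega>)))" for \<theta>
    proof -
      have char: "char (distr M' borel (W t1 s)) \<theta> = of_real (exp (- (\<theta>\<^sup>2 * t1 / 2) * s))" if "0 \<le> s" for s \<theta>
        using M'.char_brownian_sheet[OF W, of t1 s \<theta>] that t by (simp add: mult_ac)
      note law = M'.random_time_law[of "W t1", OF W_meas[OF t(1)] W_cont(2)[OF t(1)]
          L_meas[OF t(2)] L_nonneg[OF t(2)] indep_LW[OF t(2) t(1)] t(1) char]
      show "real_distribution (distr (completion M') borel (\<lambda>\<omega>. W t1 (L t2 \<omega>) \<omega>))"
        by (rule law(1))
      show "char (distr (completion M') borel (\<lambda>\<omega>. W t1 (L t2 \<omega>) \<omega>)) \<theta>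
          = of_real (M'.expectation (\<lambda>\<omega>. exp (- (\<theta>\<^sup>2 * t1 / 2) * L t2 \<omega>)))"
        by (rule law(2))
    qed
    show "real_distribution (distr (completion M') borel (\<lambda>\<omega>. W t1 (L t2 \<omega>) \<omega>))"
      by (rule law)
    show "char (distr (completion M') borel (\<lambda>\<omega>. W t1 (L t2 \<omega>) \<omega>)) \<theta>
        = of_real (mittag_leffler \<alpha> (- (t2 powr \<alpha> * t1 * (\<theta>\<^sup>2 / 2))))" for \<theta>
      unfolding law L_laplace[OF t(2)] by (simp add: mult_ac)
  qed (use t in \<open>auto intro: N2_meas\<close>)
  ultimately show ?thesis ..
qed

end
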